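(* Let $\mathcal A$ be a von Neumann algebra and $G$ a group of normal $*$-automorphisms of $\mathcal A$. (1) If $\varphi$ is a faithful normal $G$-quasi-invariant state on $\mathcal A$ with cocycle $(x_g)_{g\in G}$ satisfying the uniform boundedness assumption (A), then there exist a normal faithful $G$-invariant state $\psi$ on $\mathcal A$ and a bounded operator $d\in\mathcal A$ such that $$\psi(a)=\varphi(da)\quad\text{for all } a\in\mathcal A.$$ (2) Conversely, let $\varphi$ be a state on $\mathcal A$. If there exist a normal faithful $G$-invariant state $\psi$ on $\mathcal A$ and a bounded invertible operator $d\in\mathcal A$ such that $$\psi(a)=\varphi(da)\quad\text{for all } a\in\mathcal A,$$ then $\varphi$ is a (faithful) normal $G$-quasi-invariant state on $\mathcal A$ with cocycle $(x_g)_{g\in G}$ satisfying (A).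
   Context: A faithful normal state $\varphi$ on $\mathcal A$ is called $G$-quasi-invariant if for every $g\in G$ there exists $x_g\in\mathcal A$ such that $\varphi(g(a))=\varphi(x_g a)$ for all $a\in\mathcal A$. The element $x_g$ is unique, and $(x_g)_{g\in G}$ is called the cocycle of $\varphi$. Assumption (A): there exists $\lambda>0$ such that $\|x_g\|\le\lambda$ for all $g\in G$. A state $\psi$ is $G$-invariant if $\psi\circ g=\psi$ for all $g\in G$. *)

theory Defs
  imports "HOL-Analysis.Analysis" "HOL-Algebra.Bij"
begin

section \<open>Complex Hilbert spaces\<close>

text \<open>A complex Hilbert space is a complete real inner product space (which supplies norm and
  topology) with a compatible complex structure and a complex inner product whose real part is the
  given real one.  The complex inner product is linear in its second argument.\<close>

class chilbert_space = real_inner + complete_space +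
  fixes scaleC :: "complex \<Rightarrow> 'a \<Rightarrow> 'a"  (infixr "*\<^sub>C" 75)
    and cinner :: "'a \<Rightarrow> 'a \<Rightarrow> complex"
  assumes scaleC_add_right: "c *\<^sub>C (x + y) = c *\<^sub>C x + c *\<^sub>C y"
    and scaleC_add_left: "(c + d) *\<^sub>C x = c *\<^sub>C x + d *\<^sub>C x"
    and scaleC_scaleC: "c *\<^sub>C d *\<^sub>C x = (c * d) *\<^sub>C x"
    and scaleR_eq_scaleC: "r *\<^sub>R x = complex_of_real r *\<^sub>C x"
    and cinner_commute: "cinner x y = cnj (cinner y x)"
    and cinner_add_right: "cinner x (y + z) = cinner x y + cinner x z"
    and cinner_scaleC_right: "cinner x (c *\<^sub>C y) = c * cinner x y"
    and inner_eq_Re_cinner: "inner x y = Re (cinner x y)"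

instantiation complex :: chilbert_space
begin
definition scaleC_complex :: "complex \<Rightarrow> complex \<Rightarrow> complex" where "scaleC_complex c x = c * x"
definition cinner_complex :: "complex \<Rightarrow> complex \<Rightarrow> complex" where "cinner_complex x y = cnj x * y"
instance
  by standard
    (auto simp: scaleC_complex_def cinner_complex_def algebra_simps scaleR_conv_of_real
      inner_complex_def)
end

lemma cinner_add_left: "cinner (x + y) z = cinner x z + cinner y (z :: 'h::chilbert_space)"
  by (metis cinner_add_right cinner_commute complex_cnj_add)

lemma cinner_scaleC_left: "cinner (c *\<^sub>C x) y = cnj c * cinner x (y :: 'h::chilbert_space)"
  by (metis cinner_commute cinner_scaleC_right complex_cnj_mult)

lemma Im_cinner: "Im (cinner x y) = - inner x (\<i> *\<^sub>C (y :: 'h::chilbert_space))"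
  by (simp add: inner_eq_Re_cinner cinner_scaleC_right)

lemma inner_left_eqI:
  assumes "\<And>y. inner x y = inner x' (y :: 'h::chilbert_space)"
  shows "x = x'"
  using assms by (metis inner_diff_left inner_eq_zero_iff right_minus_eq)

lemma norm_scaleC: "norm (c *\<^sub>C (x :: 'h::chilbert_space)) = cmod c * norm x"
proof -
  have "(norm (c *\<^sub>C x))\<^sup>2 = Re (cnj c * c * cinner x x)"
    by (simp add: power2_norm_eq_inner inner_eq_Re_cinner cinner_scaleC_right cinner_scaleC_left
        algebra_simps)
  also have "cnj c * c = complex_of_real ((cmod c)\<^sup>2)"
    by (metis complex_norm_square mult.commute)
  also have "Re (complex_of_real ((cmod c)\<^sup>2) * cinner x x) = (cmod c * norm x)\<^sup>2"
    by (simp add: power_mult_distrib power2_norm_eq_inner inner_eq_Re_cinner del: of_real_power)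
  finally show ?thesis by (simp add: power2_eq_iff_nonneg)
qed

section \<open>Bounded operators\<close>

definition bounded_ops :: "('h::chilbert_space \<Rightarrow>\<^sub>L 'h) set" where
  "bounded_ops = {a. \<forall>c x. blinfun_apply a (c *\<^sub>C x) = c *\<^sub>C blinfun_apply a x}"

definition op_scale :: "complex \<Rightarrow> ('h::chilbert_space \<Rightarrow>\<^sub>L 'h) \<Rightarrow> ('h \<Rightarrow>\<^sub>L 'h)" where
  "op_scale c a = Blinfun (\<lambda>x. c *\<^sub>C blinfun_apply a x)"

definition adj :: "('h::chilbert_space \<Rightarrow>\<^sub>L 'h) \<Rightarrow> ('h \<Rightarrow>\<^sub>L 'h)" where
  "adj a = (THE b. \<forall>x y. cinner (blinfun_apply b x) y = cinner x (blinfun_apply a y))"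

definition self_adjoint :: "('h::chilbert_space \<Rightarrow>\<^sub>L 'h) \<Rightarrow> bool" where
  "self_adjoint a \<longleftrightarrow> a \<in> bounded_ops \<and> adj a = a"

definition positive_op :: "('h::chilbert_space \<Rightarrow>\<^sub>L 'h) \<Rightarrow> bool" where
  "positive_op a \<longleftrightarrow> a \<in> bounded_ops \<and>
     (\<forall>x. cinner x (blinfun_apply a x) \<in> \<real> \<and> 0 \<le> Re (cinner x (blinfun_apply a x)))"

definition op_le :: "('h::chilbert_space \<Rightarrow>\<^sub>L 'h) \<Rightarrow> ('h \<Rightarrow>\<^sub>L 'h) \<Rightarrow> bool" where
  "op_le a b \<longleftrightarrow> positive_op (b - a)"

definition op_invertible :: "('h::chilbert_space \<Rightarrow>\<^sub>L 'h) \<Rightarrow> bool" where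
  "op_invertible d \<longleftrightarrow> (\<exists>e\<in>bounded_ops. d o\<^sub>L e = id_blinfun \<and> e o\<^sub>L d = id_blinfun)"

lemma blinfun_apply_op_scale: "blinfun_apply (op_scale c a) x = c *\<^sub>C blinfun_apply a x"
proof -
  have "bounded_linear (\<lambda>x. c *\<^sub>C (x :: 'a))"
  proof (rule bounded_linear_intro[where K = "cmod c"])
    show "c *\<^sub>C r *\<^sub>R x = r *\<^sub>R c *\<^sub>C x" for r and x :: 'a
      by (simp add: scaleR_eq_scaleC scaleC_scaleC mult.commute)
  qed (simp_all add: scaleC_add_right norm_scaleC mult.commute)
  then have "bounded_linear (\<lambda>x. c *\<^sub>C blinfun_apply a x)"
    by (rule bounded_linear_compose) (rule blinfun.bounded_linear_right)
  then show ?thesis by (simp add: op_scale_def bounded_linear_Blinfun_apply)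
qed

text \<open>The Riesz representation theorem, needed only to see that \<open>adj\<close> is well defined.\<close>

lemma riesz_real:
  fixes f :: "'h::{real_inner, complete_space} \<Rightarrow> real"
  assumes "bounded_linear f"
  shows "\<exists>z. \<forall>x. f x = inner z x"
proof -
  interpret f: bounded_linear f by fact
  obtain K where K: "\<And>x. \<bar>f x\<bar> \<le> norm x * K" "K \<ge> 0"
    using f.nonneg_bounded by auto
  define q where "q x = (norm x)\<^sup>2 - 2 * f x" for x
  have low: "- K\<^sup>2 \<le> q x" for x
  proof -
    have "0 \<le> (norm x - K)\<^sup>2" by simp
    then show ?thesis using K(1)[of x] unfolding q_def power2_diff by (simp add: algebra_simps abs_le_iff)
  qed
  define m where "m = Inf (range q)"
  have bdd: "bdd_below (range q)" using low by (intro bdd_belowI[of _ "- K\<^sup>2"]) auto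
  have mle: "m \<le> q x" for x unfolding m_def by (rule cInf_lower) (use bdd in auto)
  have "\<exists>x. q x < m + 1 / Suc n" for n :: nat
  proof -
    have "\<exists>y\<in>range q. y < m + 1 / Suc n"
      by (rule cInf_lessD) (auto simp: m_def)
    then show ?thesis by auto
  qed
  then obtain u where u: "\<And>n::nat. q (u n) < m + 1 / Suc n" by metis
  have par: "(norm (x - y))\<^sup>2 = 2 * q x + 2 * q y - 4 * q ((1/2) *\<^sub>R (x + y))" for x y
    by (simp add: q_def power2_norm_eq_inner f.scaleR f.add inner_commute algebra_simps)
  have est: "(norm (u i - u j))\<^sup>2 \<le> 2 / Suc i + 2 / Suc j" for i j
    using par[of "u i" "u j"] u[of i] u[of j] mle[of "(1/2) *\<^sub>R (u i + u j)"]
    by linarith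
  have "Cauchy u"
  proof (rule CauchyI)
    fix e :: real assume e: "e > 0"
    obtain N :: nat where N: "4 / e\<^sup>2 < N" using reals_Archimedean2 by blast
    have "norm (u i - u j) < e" if "i \<ge> N" "j \<ge> N" for i j
    proof -
      have "2 / Suc i \<le> 2 / Suc N" "2 / Suc j \<le> 2 / Suc N" using that by (auto simp: field_simps)
      then have "(norm (u i - u j))\<^sup>2 \<le> 4 / Suc N" using est[of i j] by linarith
      also have "\<dots> < e\<^sup>2" using N e by (simp add: field_simps add_pos_pos add_strict_increasing)
      finally show ?thesis using e by (simp add: power_less_imp_less_base)
    qed
    then show "\<exists>N. \<forall>i\<ge>N. \<forall>j\<ge>N. norm (u i - u j) < e" by blast
  qed
  then obtain z where z: "u \<longlonglongrightarrow> z" using Cauchy_convergent convergent_def by blast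
  have "(\<lambda>n. q (u n)) \<longlonglongrightarrow> q z"
    unfolding q_def by (intro tendsto_intros z f.tendsto)
  moreover have "(\<lambda>n. m + 1 / real (Suc n)) \<longlonglongrightarrow> m + 0"
    by (intro tendsto_intros LIMSEQ_Suc[OF lim_1_over_n])
  ultimately have "q z \<le> m + 0"
    by (rule LIMSEQ_le) (use less_imp_le[OF u] in blast)
  then have qz: "q z \<le> q x" for x using mle[of x] by simp
  have "f x = inner z x" for x
  proof -
    define s where "s = inner z x - f x"
    define P where "P = (norm x)\<^sup>2 + 1"
    define t where "t = - s / P"
    have p: "P > 0" by (simp add: P_def add_nonneg_pos)
    have "q (z + t *\<^sub>R x) = q z + 2 * t * s + t * t * (norm x)\<^sup>2"
      by (simp add: q_def s_def power2_norm_eq_inner f.scaleR f.add inner_commute algebra_simps)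
    then have "0 \<le> 2 * t * s + t\<^sup>2 * (norm x)\<^sup>2"
      using qz[of "z + t *\<^sub>R x"] by (simp add: power2_eq_square)
    also have "\<dots> \<le> 2 * t * s + t\<^sup>2 * P" by (simp add: P_def mult_left_mono)
    also have "\<dots> = - (s\<^sup>2 / P)"
      using p by (simp add: t_def power2_eq_square field_simps)
    finally have "s\<^sup>2 \<le> 0" using p by (simp add: divide_le_0_iff)
    then show ?thesis by (simp add: s_def)
  qed
  then show ?thesis by blast
qed

lemma adj_exists:
  fixes a :: "'h::chilbert_space \<Rightarrow>\<^sub>L 'h"
  assumes a: "a \<in> bounded_ops"
  shows "\<exists>b. \<forall>x y. cinner (blinfun_apply b x) y = cinner x (blinfun_apply a y)"
proof -
  have "\<exists>z. \<forall>y. inner x (blinfun_apply a y) = inner z y" for x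
    by (rule riesz_real)
      (rule bounded_linear_compose[OF bounded_linear_inner_right blinfun.bounded_linear_right])
  then obtain b where b: "\<And>x y. inner x (blinfun_apply a y) = inner (b x) y" by metis
  have bl: "bounded_linear b"
  proof (rule bounded_linear_intro[where K = "norm a"])
    show "b (x + y) = b x + b y" for x y
      by (rule inner_left_eqI) (simp add: b[symmetric] inner_add_left)
    show "b (r *\<^sub>R x) = r *\<^sub>R b x" for r x
      by (rule inner_left_eqI) (simp add: b[symmetric])
    show "norm (b x) \<le> norm x * norm a" for x
    proof -
      have "norm (b x) * norm (b x) = inner x (blinfun_apply a (b x))"
        by (simp add: b power2_norm_eq_inner flip: power2_eq_square)
      also have "\<dots> \<le> norm x * norm (blinfun_apply a (b x))" by (rule norm_cauchy_schwarz)
      also have "\<dots> \<le> norm x * (norm a * norm (b x))"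
        by (intro mult_left_mono norm_blinfun) auto
      finally have "norm (b x) * norm (b x) \<le> (norm x * norm a) * norm (b x)"
        by (simp add: mult.assoc)
      then show ?thesis
        by (cases "norm (b x) = 0") auto
    qed
  qed
  have "cinner (b x) y = cinner x (blinfun_apply a y)" for x y
  proof (rule complex_eqI)
    show "Re (cinner (b x) y) = Re (cinner x (blinfun_apply a y))"
      using b[of x y] by (simp add: inner_eq_Re_cinner)
    show "Im (cinner (b x) y) = Im (cinner x (blinfun_apply a y))"
      using b[of x "\<i> *\<^sub>C y"] a by (simp add: Im_cinner bounded_ops_def)
  qed
  then show ?thesis
    by (intro exI[of _ "Blinfun b"]) (simp add: bounded_linear_Blinfun_apply[OF bl])
qed

lemma cinner_adj:
  assumes "a \<in> bounded_ops"
  shows "cinner (blinfun_apply (adj a) x) y = cinner x (blinfun_apply a y)"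
proof -
  have "\<exists>!b. \<forall>x y. cinner (blinfun_apply b x) y = cinner x (blinfun_apply a y)"
  proof (rule ex_ex1I[OF adj_exists[OF assms]])
    fix b b' assume "\<forall>x y. cinner (blinfun_apply b x) y = cinner x (blinfun_apply a y)"
      "\<forall>x y. cinner (blinfun_apply b' x) y = cinner x (blinfun_apply a y)"
    then show "b = b'"
      by (intro blinfun_eqI inner_left_eqI) (simp add: inner_eq_Re_cinner)
  qed
  from theI'[OF this] show ?thesis unfolding adj_def by blast
qed

section \<open>Von Neumann algebras\<close>

definition commutant :: "('h::chilbert_space \<Rightarrow>\<^sub>L 'h) set \<Rightarrow> ('h \<Rightarrow>\<^sub>L 'h) set" where
  "commutant S = {b \<in> bounded_ops. \<forall>a\<in>S. a o\<^sub>L b = b o\<^sub>L a}"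

definition von_neumann_algebra :: "('h::chilbert_space \<Rightarrow>\<^sub>L 'h) set \<Rightarrow> bool" where
  "von_neumann_algebra A \<longleftrightarrow>
     A \<subseteq> bounded_ops \<and> id_blinfun \<in> A \<and>
     (\<forall>a\<in>A. \<forall>b\<in>A. a + b \<in> A \<and> a o\<^sub>L b \<in> A) \<and>
     (\<forall>a\<in>A. \<forall>c. op_scale c a \<in> A) \<and>
     (\<forall>a\<in>A. adj a \<in> A) \<and>
     commutant (commutant A) = A"

definition op_directed :: "('h::chilbert_space \<Rightarrow>\<^sub>L 'h) set \<Rightarrow> bool" where
  "op_directed D \<longleftrightarrow> D \<noteq> {} \<and> (\<forall>a\<in>D. \<forall>b\<in>D. \<exists>c\<in>D. op_le a c \<and> op_le b c)"

definition op_lub :: "('h::chilbert_space \<Rightarrow>\<^sub>L 'h) set \<Rightarrow> ('h \<Rightarrow>\<^sub>L 'h) set \<Rightarrow> ('h \<Rightarrow>\<^sub>L 'h) \<Rightarrow> bool"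
  where "op_lub A D b \<longleftrightarrow> b \<in> A \<and> self_adjoint b \<and> (\<forall>a\<in>D. op_le a b) \<and>
     (\<forall>c\<in>A. self_adjoint c \<longrightarrow> (\<forall>a\<in>D. op_le a c) \<longrightarrow> op_le b c)"

text \<open>Normality of maps means preservation of least upper bounds of bounded increasing nets of
  self-adjoint elements; the range of such a net is an upward directed set.\<close>

definition normal_star_automorphism ::
  "('h::chilbert_space \<Rightarrow>\<^sub>L 'h) set \<Rightarrow> (('h \<Rightarrow>\<^sub>L 'h) \<Rightarrow> ('h \<Rightarrow>\<^sub>L 'h)) \<Rightarrow> bool" where
  "normal_star_automorphism A g \<longleftrightarrow>
     bij_betw g A A \<and>
     (\<forall>a\<in>A. \<forall>b\<in>A. g (a + b) = g a + g b \<and> g (a o\<^sub>L b) = g a o\<^sub>L g b) \<and>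
     (\<forall>a\<in>A. \<forall>c. g (op_scale c a) = op_scale c (g a)) \<and>
     (\<forall>a\<in>A. g (adj a) = adj (g a)) \<and>
     (\<forall>D b. D \<subseteq> A \<longrightarrow> (\<forall>a\<in>D. self_adjoint a) \<longrightarrow> op_directed D \<longrightarrow> op_lub A D b
        \<longrightarrow> op_lub A (g ` D) (g b))"

text \<open>The elements of \<open>carrier (BijGroup A)\<close> are the bijections of \<open>A\<close>, represented as
  functions that are \<open>undefined\<close> outside \<open>A\<close>; the group operation is composition.\<close>

definition normal_automorphism_group ::
  "('h::chilbert_space \<Rightarrow>\<^sub>L 'h) set \<Rightarrow> (('h \<Rightarrow>\<^sub>L 'h) \<Rightarrow> ('h \<Rightarrow>\<^sub>L 'h)) set \<Rightarrow> bool" where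
  "normal_automorphism_group A G \<longleftrightarrow>
     subgroup G (BijGroup A) \<and> (\<forall>g\<in>G. normal_star_automorphism A g)"

section \<open>States\<close>

text \<open>Functionals on \<open>A\<close> are total functions of which only the values on \<open>A\<close> matter.\<close>

definition state :: "('h::chilbert_space \<Rightarrow>\<^sub>L 'h) set \<Rightarrow> (('h \<Rightarrow>\<^sub>L 'h) \<Rightarrow> complex) \<Rightarrow> bool" where
  "state A \<phi> \<longleftrightarrow>
     (\<forall>a\<in>A. \<forall>b\<in>A. \<phi> (a + b) = \<phi> a + \<phi> b) \<and>
     (\<forall>a\<in>A. \<forall>c. \<phi> (op_scale c a) = c * \<phi> a) \<and>
     (\<forall>a\<in>A. positive_op a \<longrightarrow> \<phi> a \<in> \<real> \<and> 0 \<le> Re (\<phi> a)) \<and>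
     \<phi> id_blinfun = 1"

definition faithful :: "('h::chilbert_space \<Rightarrow>\<^sub>L 'h) set \<Rightarrow> (('h \<Rightarrow>\<^sub>L 'h) \<Rightarrow> complex) \<Rightarrow> bool" where
  "faithful A \<phi> \<longleftrightarrow> (\<forall>a\<in>A. positive_op a \<longrightarrow> \<phi> a = 0 \<longrightarrow> a = 0)"

definition normal_state :: "('h::chilbert_space \<Rightarrow>\<^sub>L 'h) set \<Rightarrow> (('h \<Rightarrow>\<^sub>L 'h) \<Rightarrow> complex) \<Rightarrow> bool"
  where "normal_state A \<phi> \<longleftrightarrow> state A \<phi> \<and>
     (\<forall>D b. D \<subseteq> A \<longrightarrow> (\<forall>a\<in>D. self_adjoint a) \<longrightarrow> op_directed D \<longrightarrow> op_lub A D b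
        \<longrightarrow> Re (\<phi> b) = (SUP a\<in>D. Re (\<phi> a)))"

definition invariant ::
  "('h::chilbert_space \<Rightarrow>\<^sub>L 'h) set \<Rightarrow> (('h \<Rightarrow>\<^sub>L 'h) \<Rightarrow> ('h \<Rightarrow>\<^sub>L 'h)) set
     \<Rightarrow> (('h \<Rightarrow>\<^sub>L 'h) \<Rightarrow> complex) \<Rightarrow> bool" where
  "invariant A G \<psi> \<longleftrightarrow> (\<forall>g\<in>G. \<forall>a\<in>A. \<psi> (g a) = \<psi> a)"

definition quasi_invariant ::
  "('h::chilbert_space \<Rightarrow>\<^sub>L 'h) set \<Rightarrow> (('h \<Rightarrow>\<^sub>L 'h) \<Rightarrow> ('h \<Rightarrow>\<^sub>L 'h)) set
     \<Rightarrow> (('h \<Rightarrow>\<^sub>L 'h) \<Rightarrow> complex) \<Rightarrow> bool" where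
  "quasi_invariant A G \<phi> \<longleftrightarrow> normal_state A \<phi> \<and> faithful A \<phi> \<and>
     (\<forall>g\<in>G. \<exists>x\<in>A. \<forall>a\<in>A. \<phi> (g a) = \<phi> (x o\<^sub>L a))"

definition is_cocycle ::
  "('h::chilbert_space \<Rightarrow>\<^sub>L 'h) set \<Rightarrow> (('h \<Rightarrow>\<^sub>L 'h) \<Rightarrow> ('h \<Rightarrow>\<^sub>L 'h)) set
     \<Rightarrow> (('h \<Rightarrow>\<^sub>L 'h) \<Rightarrow> complex) \<Rightarrow> ((('h \<Rightarrow>\<^sub>L 'h) \<Rightarrow> ('h \<Rightarrow>\<^sub>L 'h)) \<Rightarrow> ('h \<Rightarrow>\<^sub>L 'h)) \<Rightarrow> bool" where
  "is_cocycle A G \<phi> x \<longleftrightarrow> (\<forall>g\<in>G. x g \<in> A \<and> (\<forall>a\<in>A. \<phi> (g a) = \<phi> (x g o\<^sub>L a)))"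

definition uniformly_bounded ::
  "(('h::chilbert_space \<Rightarrow>\<^sub>L 'h) \<Rightarrow> ('h \<Rightarrow>\<^sub>L 'h)) set
     \<Rightarrow> ((('h \<Rightarrow>\<^sub>L 'h) \<Rightarrow> ('h \<Rightarrow>\<^sub>L 'h)) \<Rightarrow> ('h \<Rightarrow>\<^sub>L 'h)) \<Rightarrow> bool" where
  "uniformly_bounded G x \<longleftrightarrow> (\<exists>l>0. \<forall>g\<in>G. norm (x g) \<le> l)"

lemma cocycle_unique:
  assumes A: "von_neumann_algebra A" and \<phi>: "state A \<phi>" "faithful A \<phi>"
    and x: "is_cocycle A G \<phi> x" and y: "is_cocycle A G \<phi> y"
    and G: "g \<in> G"
  shows "x g = y g"
proof -
  define z where "z = x g - y g"
  have m1: "op_scale (-1) a = - a" if "a \<in> A" for a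
  proof (rule blinfun_eqI)
    show "blinfun_apply (op_scale (-1) a) i = blinfun_apply (- a) i" for i
      using scaleR_eq_scaleC[of "-1" "blinfun_apply a i"]
      by (simp add: blinfun_apply_op_scale blinfun.minus_left)
  qed
  have xA: "x g \<in> A" and yA: "y g \<in> A" using x y G by (auto simp: is_cocycle_def)
  have negA: "- a \<in> A" if "a \<in> A" for a
    using A that m1[OF that] by (metis von_neumann_algebra_def)
  have zA: "z \<in> A"
  proof -
    have "x g + (- y g) \<in> A" using A xA negA[OF yA] unfolding von_neumann_algebra_def by blast
    then show ?thesis by (simp add: z_def)
  qed
  have zB: "z \<in> bounded_ops" and z'A: "adj z \<in> A" and z'B: "adj z \<in> bounded_ops"
    using A zA by (auto simp: von_neumann_algebra_def)
  have pA: "x g o\<^sub>L adj z \<in> A" "y g o\<^sub>L adj z \<in> A" "z o\<^sub>L adj z \<in> A"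
    using A xA yA zA z'A by (auto simp: von_neumann_algebra_def)
  have eq: "z o\<^sub>L adj z = (x g o\<^sub>L adj z) + op_scale (-1) (y g o\<^sub>L adj z)"
    unfolding m1[OF pA(2)]
    by (rule blinfun_eqI) (simp add: z_def blinfun.diff_left blinfun.add_left blinfun.minus_left)
  have "\<phi> (z o\<^sub>L adj z) = \<phi> (x g o\<^sub>L adj z) - \<phi> (y g o\<^sub>L adj z)"
    unfolding eq using \<phi>(1) pA negA[OF pA(2)] m1[OF pA(2)] unfolding state_def
    by (metis add_uminus_conv_diff mult_minus1)
  also have "\<dots> = 0" using x y G z'A unfolding is_cocycle_def by (metis diff_self)
  finally have 0: "\<phi> (z o\<^sub>L adj z) = 0" .
  have sq: "cinner v (blinfun_apply (z o\<^sub>L adj z) v) =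
      cinner (blinfun_apply (adj z) v) (blinfun_apply (adj z) v)" for v
    using cinner_adj[OF zB, of v "blinfun_apply (adj z) v"] by simp
  have re: "cinner v v \<in> \<real>" for v :: 'a
    using cinner_commute[of v v] by (metis Reals_cnj_iff)
  have "positive_op (z o\<^sub>L adj z)"
    unfolding positive_op_def sq
    using A pA(3) re by (auto simp: von_neumann_algebra_def simp flip: inner_eq_Re_cinner)
  with 0 pA(3) \<phi>(2) have "z o\<^sub>L adj z = 0" by (auto simp: faithful_def)
  then have "inner (blinfun_apply (adj z) v) (blinfun_apply (adj z) v) = 0" for v
    using sq[of v] by (simp add: inner_eq_Re_cinner) (metis inner_eq_Re_cinner inner_zero_right)
  then have "blinfun_apply (adj z) v = 0" for v by simp
  then have "inner v (blinfun_apply z w) = 0" for v w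
    using cinner_adj[OF zB, of v w] by (metis inner_eq_Re_cinner inner_zero_left)
  then have "blinfun_apply z w = 0" for w by (metis inner_eq_zero_iff)
  then have "z = 0" by (intro blinfun_eqI) simp
  then show ?thesis by (simp add: z_def)
qed

end

theory Submission
  imports Defs
begin

text \<open>
  The translate of \<open>\<phi>\<close> by \<open>g \<in> G\<close> has the density \<open>x\<^sub>g\<close> with respect to \<open>\<phi>\<close>, so part (1) asks for a
  fixed point of the translation action of \<open>G\<close> on densities.  Since \<open>G\<close> may fail to be amenable, the
  fixed point is not found by averaging but by uniform convexity.  The functional \<open>\<phi> (y \<cdot>)\<close> has the squared Hilbert norm \<open>\<phi> (y y\<^sup>*)\<close>, which
  satisfies the parallelogram law.  If \<open>\<phi> (x \<cdot>)\<close> is positive then \<open>\<phi> (x \<cdot>) \<le> \<parallel>x\<parallel> \<phi>\<close>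
  (\<open>positive_twist_le\<close>), so the bound on the cocycle makes all translates of \<open>\<phi>\<close> uniformly
  equivalent to \<open>\<phi>\<close>.  Consequently the supremum over \<open>G\<close> of the squared norms of the translates is
  finite, does not increase under \<open>G\<close>, and is still uniformly convex
  (\<open>sup_sqnorm_uniformly_convex\<close>).  Its minimising sequences are Cauchy sequences, and translating
  one gives another, so their common limit \<open>\<psi>\<close> is invariant (\<open>invariant_limit\<close>).  It lies between
  two positive multiples of \<open>\<phi>\<close>, and therefore is faithful and normal.

  It remains to find a density of \<open>\<psi>\<close> in \<open>A\<close> (\<open>bounded_density_limit\<close>).  The minimising densities
  are bounded, so they have a weak operator cluster point \<open>d \<in> A\<close> (\<open>weak_cluster_point\<close>).  That
  \<open>\<psi> = \<phi> (d \<cdot>)\<close> needs a weak continuity property of \<open>\<phi>\<close>, whereas normality is defined by least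
  upper bounds.  The bridge is that below suitable \<open>b > 0\<close> the functional \<open>\<phi>\<close> is dominated by a
  vector functional (\<open>vector_dominated_exists\<close>); then \<open>\<phi> (\<cdot> b)\<close> is a matrix coefficient
  (\<open>vector_dominated_coefficient\<close>) and \<open>\<phi> (d a b) = \<psi> (a b)\<close>.  Normality lets such \<open>b\<close> exhaust
  the identity (\<open>vanishing_by_exhaustion\<close>).  Working with positive elements instead of projections
  keeps spectral theory out of the argument.

  For part (2), let \<open>e = d\<^sup>-\<^sup>1\<close>, which lies in \<open>A\<close> by the bicommutant property.  Invariance of \<open>\<psi>\<close>
  turns \<open>\<phi> (g a) = \<psi> (e g(a))\<close> into \<open>\<psi> (g\<^sup>-\<^sup>1(e) a) = \<phi> (d g\<^sup>-\<^sup>1(e) a)\<close>, so \<open>x\<^sub>g = d g\<^sup>-\<^sup>1(e)\<close> is a cocycle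
  bounded by \<open>\<parallel>d\<parallel> \<parallel>e\<parallel>\<close>, and the estimate \<open>positive_twist_le\<close> for \<open>d\<close> and \<open>e\<close> carries faithfulness and
  normality from \<open>\<psi>\<close> to \<open>\<phi>\<close>.
\<close>

section \<open>Operators and adjoints\<close>

lemma inner_scaleC_left:
  "inner (c *\<^sub>C x) y = inner x (cnj c *\<^sub>C (y :: 'h::chilbert_space))"
  by (simp add: inner_eq_Re_cinner cinner_scaleC_left cinner_scaleC_right)

lemma op_scale_of_real: "op_scale (complex_of_real r) a = r *\<^sub>R a"
  by (rule blinfun_eqI) (simp add: blinfun_apply_op_scale blinfun.scaleR_left scaleR_eq_scaleC)

lemma inner_adj:
  "a \<in> bounded_ops \<Longrightarrow> inner (blinfun_apply (adj a) x) y = inner x (blinfun_apply a y)"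
  by (simp add: inner_eq_Re_cinner cinner_adj)

lemma inner_adj_right:
  "a \<in> bounded_ops \<Longrightarrow> inner x (blinfun_apply (adj a) y) = inner (blinfun_apply a x) y"
  by (metis inner_adj inner_commute)

lemma adj_eqI:
  assumes "a \<in> bounded_ops" "\<And>x y. inner (blinfun_apply b x) y = inner x (blinfun_apply a y)"
  shows "adj a = b"
  by (intro blinfun_eqI inner_left_eqI) (simp add: inner_adj assms)

lemma positive_op_iff:
  "positive_op a \<longleftrightarrow>
     a \<in> bounded_ops \<and> adj a = a \<and> (\<forall>x. 0 \<le> inner x (blinfun_apply a x))"
proof safe
  assume a: "positive_op a"
  then show b: "a \<in> bounded_ops" by (simp add: positive_op_def)
  have re: "inner x (blinfun_apply a (\<i> *\<^sub>C x)) = 0" for x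
  proof -
    have "Im (cinner x (blinfun_apply a x)) = 0"
      using a by (simp add: positive_op_def complex_is_Real_iff)
    then show ?thesis using b by (simp add: Im_cinner bounded_ops_def)
  qed
  show "adj a = a"
  proof (rule adj_eqI[OF b])
    \<comment> \<open>Polarisation: the real bilinear form of \<open>\<i> a\<close> vanishes on the diagonal, hence is
      antisymmetric.\<close>
    fix x y
    let ?w = "\<i> *\<^sub>C (x::'a)"
    have ii: "\<i> *\<^sub>C \<i> *\<^sub>C z = - z" for z :: 'a
      using scaleR_eq_scaleC[of "-1" z] by (simp add: scaleC_scaleC)
    have "inner (y + ?w) (blinfun_apply a (\<i> *\<^sub>C (y + ?w))) = 0" by (rule re)
    then have "inner y (blinfun_apply a (\<i> *\<^sub>C ?w)) + inner ?w (blinfun_apply a (\<i> *\<^sub>C y)) = 0"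
      using re[of y] re[of ?w]
      by (simp add: scaleC_add_right blinfun.add_right inner_add_left inner_add_right)
    moreover have "inner ?w (blinfun_apply a (\<i> *\<^sub>C y)) = inner x (blinfun_apply a y)"
    proof -
      have "blinfun_apply a (\<i> *\<^sub>C y) = \<i> *\<^sub>C blinfun_apply a y"
        using b by (simp add: bounded_ops_def)
      moreover have "cnj \<i> *\<^sub>C \<i> *\<^sub>C z = z" for z :: 'a
        using scaleR_eq_scaleC[of 1 z] by (simp add: scaleC_scaleC)
      ultimately show ?thesis by (simp only: inner_scaleC_left)
    qed
    ultimately show "inner (blinfun_apply a x) y = inner x (blinfun_apply a y)"
      by (simp add: ii blinfun.minus_right inner_commute)
  qed
  show "0 \<le> inner x (blinfun_apply a x)" for x
    using a by (simp add: positive_op_def inner_eq_Re_cinner)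
next
  assume b: "a \<in> bounded_ops" and s: "adj a = a" and p: "\<forall>x. 0 \<le> inner x (blinfun_apply a x)"
  have "cinner x (blinfun_apply a x) \<in> \<real>" for x
    using cinner_adj[OF b, of x x] cinner_commute[of "blinfun_apply a x" x] s
    by (metis Reals_cnj_iff)
  then show "positive_op a" using b p by (simp add: positive_op_def inner_eq_Re_cinner)
qed

lemma norm_adj_le:
  assumes "a \<in> bounded_ops" shows "norm (adj a) \<le> norm a"
proof (rule norm_blinfun_bound)
  fix x
  let ?y = "blinfun_apply (adj a) x"
  have "norm ?y * norm ?y = inner x (blinfun_apply a ?y)"
    using inner_adj[OF assms, of x ?y] by (simp add: power2_norm_eq_inner flip: power2_eq_square)
  also have "\<dots> \<le> norm x * norm (blinfun_apply a ?y)" by (rule norm_cauchy_schwarz)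
  also have "\<dots> \<le> norm x * (norm a * norm ?y)" by (intro mult_left_mono norm_blinfun) auto
  finally have "norm ?y * norm ?y \<le> (norm a * norm x) * norm ?y" by (simp add: algebra_simps)
  then show "norm ?y \<le> norm a * norm x" by (cases "norm ?y = 0") auto
qed simp

lemmas compose_distribs =
  bounded_bilinear.add_left[OF bounded_bilinear_blinfun_compose]
  bounded_bilinear.add_right[OF bounded_bilinear_blinfun_compose]
  bounded_bilinear.diff_left[OF bounded_bilinear_blinfun_compose]
  bounded_bilinear.diff_right[OF bounded_bilinear_blinfun_compose]
  bounded_bilinear.scaleR_left[OF bounded_bilinear_blinfun_compose]
  bounded_bilinear.scaleR_right[OF bounded_bilinear_blinfun_compose]
  bounded_bilinear.zero_left[OF bounded_bilinear_blinfun_compose]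
  bounded_bilinear.zero_right[OF bounded_bilinear_blinfun_compose]

lemma compose_assoc: "(a o\<^sub>L b) o\<^sub>L c = a o\<^sub>L (b o\<^sub>L c)"
  by (rule blinfun_eqI) simp

lemma compose_id [simp]: "a o\<^sub>L id_blinfun = a" "id_blinfun o\<^sub>L a = a"
  by (rule blinfun_eqI, simp)+

lemma norm_compose_le: "norm (a o\<^sub>L b) \<le> norm a * norm b"
  by (rule norm_blinfun_compose)

section \<open>The order of a von Neumann algebra\<close>

locale vn_algebra =
  fixes A :: "('h::chilbert_space \<Rightarrow>\<^sub>L 'h) set"
  assumes vn: "von_neumann_algebra A"
begin

lemma bounded: "a \<in> A \<Longrightarrow> a \<in> bounded_ops"
  and id_in [simp, intro]: "id_blinfun \<in> A"
  and add_in [simp, intro]: "a \<in> A \<Longrightarrow> b \<in> A \<Longrightarrow> a + b \<in> A"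
  and comp_in [simp, intro]: "a \<in> A \<Longrightarrow> b \<in> A \<Longrightarrow> a o\<^sub>L b \<in> A"
  and op_scale_in [simp, intro]: "a \<in> A \<Longrightarrow> op_scale c a \<in> A"
  and adj_in [simp, intro]: "a \<in> A \<Longrightarrow> adj a \<in> A"
  and bicommutant: "commutant (commutant A) = A"
  using vn by (auto simp: von_neumann_algebra_def)

lemma scaleR_in [simp, intro]: "a \<in> A \<Longrightarrow> r *\<^sub>R a \<in> A"
  by (metis op_scale_in op_scale_of_real)

lemma zero_in [simp, intro]: "0 \<in> A"
  using scaleR_in[OF id_in, of 0] by simp

lemma minus_in [simp, intro]: "a \<in> A \<Longrightarrow> b \<in> A \<Longrightarrow> a - b \<in> A"
  using add_in[of a "(-1) *\<^sub>R b"] scaleR_in[of b "-1"] by simp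

lemma adj_add: "a \<in> A \<Longrightarrow> b \<in> A \<Longrightarrow> adj (a + b) = adj a + adj b"
  by (rule adj_eqI) (simp_all add: bounded blinfun.add_left inner_add_left inner_add_right inner_adj)

lemma adj_diff: "a \<in> A \<Longrightarrow> b \<in> A \<Longrightarrow> adj (a - b) = adj a - adj b"
  by (rule adj_eqI) (simp_all add: bounded blinfun.diff_left inner_diff_left inner_diff_right inner_adj)

lemma adj_scaleR: "a \<in> A \<Longrightarrow> adj (r *\<^sub>R a) = r *\<^sub>R adj a"
  by (rule adj_eqI) (simp_all add: bounded blinfun.scaleR_left inner_adj)

lemma apply_scaleC: "a \<in> A \<Longrightarrow> blinfun_apply a (c *\<^sub>C x) = c *\<^sub>C blinfun_apply a x"
  using bounded[of a] by (simp add: bounded_ops_def)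

lemma adj_op_scale: "a \<in> A \<Longrightarrow> adj (op_scale c a) = op_scale (cnj c) (adj a)"
  by (rule adj_eqI)
    (simp_all add: bounded blinfun_apply_op_scale inner_scaleC_left inner_adj apply_scaleC)

lemma adj_comp: "a \<in> A \<Longrightarrow> b \<in> A \<Longrightarrow> adj (a o\<^sub>L b) = adj b o\<^sub>L adj a"
  by (rule adj_eqI) (simp_all add: bounded inner_adj)

lemma adj_adj [simp]: "a \<in> A \<Longrightarrow> adj (adj a) = a"
  by (rule adj_eqI) (simp_all add: bounded inner_adj_right)

lemma adj_id [simp]: "adj (id_blinfun :: 'h \<Rightarrow>\<^sub>L 'h) = id_blinfun"
  by (rule adj_eqI) (use id_in bounded in auto)

lemma adj_zero [simp]: "adj (0 :: 'h \<Rightarrow>\<^sub>L 'h) = 0"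
  by (rule adj_eqI) (use zero_in bounded in auto)

lemma norm_adj [simp]: "a \<in> A \<Longrightarrow> norm (adj a) = norm a"
  by (metis adj_adj adj_in bounded norm_adj_le order_antisym)

lemma op_scale_comp_right: "a \<in> A \<Longrightarrow> a o\<^sub>L op_scale c b = op_scale c (a o\<^sub>L b)"
  by (rule blinfun_eqI) (simp add: blinfun_apply_op_scale apply_scaleC)

lemma op_scale_comp_left: "op_scale c a o\<^sub>L b = op_scale c (a o\<^sub>L b)"
  by (rule blinfun_eqI) (simp add: blinfun_apply_op_scale)

lemma positiveI:
  "a \<in> A \<Longrightarrow> adj a = a \<Longrightarrow> (\<And>x. 0 \<le> inner x (blinfun_apply a x)) \<Longrightarrow> positive_op a"
  by (simp add: positive_op_iff bounded)

lemma positive_inner: "positive_op a \<Longrightarrow> 0 \<le> inner x (blinfun_apply a x)"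
  by (simp add: positive_op_iff)

lemma positive_adj: "positive_op a \<Longrightarrow> adj a = a"
  by (simp add: positive_op_iff)

lemma positive_self_adjoint: "positive_op a \<Longrightarrow> self_adjoint a"
  by (simp add: positive_op_iff self_adjoint_def)

lemma positive_zero [simp]: "positive_op (0 :: 'h \<Rightarrow>\<^sub>L 'h)"
  by (rule positiveI) auto

lemma positive_id [simp]: "positive_op (id_blinfun :: 'h \<Rightarrow>\<^sub>L 'h)"
  by (rule positiveI) auto

lemma positive_add:
  "a \<in> A \<Longrightarrow> b \<in> A \<Longrightarrow> positive_op a \<Longrightarrow> positive_op b \<Longrightarrow> positive_op (a + b)"
  by (rule positiveI) (auto simp: adj_add positive_adj blinfun.add_left inner_add_right positive_inner)

lemma positive_scaleR: "a \<in> A \<Longrightarrow> 0 \<le> r \<Longrightarrow> positive_op a \<Longrightarrow> positive_op (r *\<^sub>R a)"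
  by (rule positiveI) (auto simp: adj_scaleR positive_adj blinfun.scaleR_left positive_inner)

lemma positive_conj:
  assumes "a \<in> A" "b \<in> A" "positive_op a" shows "positive_op (b o\<^sub>L a o\<^sub>L adj b)"
proof (rule positiveI)
  show "0 \<le> inner x (blinfun_apply (b o\<^sub>L a o\<^sub>L adj b) x)" for x
    using positive_inner[OF assms(3), of "blinfun_apply (adj b) x"] assms(2)
    by (simp add: inner_adj bounded)
qed (use assms in \<open>auto simp: adj_comp positive_adj compose_assoc\<close>)

lemma positive_square: "a \<in> A \<Longrightarrow> positive_op (adj a o\<^sub>L a)"
  using positive_conj[of id_blinfun "adj a"] by simp

lemma positive_square': "a \<in> A \<Longrightarrow> positive_op (a o\<^sub>L adj a)"
  using positive_conj[of id_blinfun a] by simp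

lemma op_le_refl [simp]: "op_le a (a :: 'h \<Rightarrow>\<^sub>L 'h)"
  by (simp add: op_le_def)

lemma op_le_trans:
  assumes "a \<in> A" "b \<in> A" "c \<in> A" "op_le a b" "op_le b c" shows "op_le a c"
  using positive_add[of "b - a" "c - b"] assms by (simp add: op_le_def)

lemma op_le_inner: "op_le a b \<Longrightarrow> inner x (blinfun_apply a x) \<le> inner x (blinfun_apply b x)"
  using positive_inner[of "b - a" x] by (simp add: op_le_def blinfun.diff_left inner_diff_right)

lemma op_leI:
  assumes "a \<in> A" "b \<in> A" "adj a = a" "adj b = b"
    "\<And>x. inner x (blinfun_apply a x) \<le> inner x (blinfun_apply b x)"
  shows "op_le a b"
  unfolding op_le_def
  by (rule positiveI) (use assms in \<open>auto simp: adj_diff blinfun.diff_left inner_diff_right\<close>)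

text \<open>The exhaustion arguments take place here, because \<open>b\<^sup>2 \<le> b\<close> replaces the idempotence of
  projections and the norm bound gives weak compactness.\<close>

definition unit_interval :: "('h \<Rightarrow>\<^sub>L 'h) set" where
  "unit_interval = {a \<in> A. positive_op a \<and> op_le a id_blinfun}"

lemma unit_intervalD:
  assumes "a \<in> unit_interval"
  shows "a \<in> A" "positive_op a" "op_le a id_blinfun" "adj a = a"
  using assms by (auto simp: unit_interval_def positive_adj)

lemma unit_interval_le:
  assumes "a \<in> A" "positive_op a" "op_le a b" "b \<in> unit_interval"
  shows "a \<in> unit_interval"
  using assms op_le_trans[of a b id_blinfun] by (auto simp: unit_interval_def)

lemma unit_interval_diff:
  assumes "b \<in> unit_interval" "a \<in> A" "positive_op a" "op_le a b"
  shows "b - a \<in> unit_interval"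
  by (rule unit_interval_le[of _ b])
    (use assms in \<open>auto simp: unit_interval_def op_le_def\<close>)

text \<open>\<open>b - b\<^sup>2 = b (1 - b) b + (1 - b) b (1 - b)\<close> exhibits a positive difference without square
  roots.\<close>

lemma square_le:
  assumes "b \<in> unit_interval" shows "op_le (b o\<^sub>L b) b"
proof -
  let ?c = "id_blinfun - b"
  note b = unit_intervalD[OF assms]
  have c: "?c \<in> A" "positive_op ?c" using b by (auto simp: op_le_def)
  have "positive_op ((b o\<^sub>L ?c o\<^sub>L b) + (?c o\<^sub>L b o\<^sub>L ?c))"
    using positive_conj[of ?c b] positive_conj[of b ?c] b c
    by (intro positive_add) (auto simp: positive_adj)
  also have "(b o\<^sub>L ?c o\<^sub>L b) + (?c o\<^sub>L b o\<^sub>L ?c) = b - (b o\<^sub>L b)"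
    by (simp add: compose_distribs compose_assoc)
  finally show ?thesis by (simp add: op_le_def)
qed

lemma norm_apply_le_inner:
  assumes "b \<in> unit_interval" shows "(norm (blinfun_apply b x))\<^sup>2 \<le> inner x (blinfun_apply b x)"
  using op_le_inner[OF square_le[OF assms], of x] unit_intervalD[OF assms]
    inner_adj[of b x "blinfun_apply b x"]
  by (simp add: bounded power2_norm_eq_inner)

lemma unit_interval_norm_le:
  assumes "b \<in> unit_interval" shows "norm b \<le> 1"
proof (rule norm_blinfun_bound)
  fix x
  have "(norm (blinfun_apply b x))\<^sup>2 \<le> (norm x)\<^sup>2"
    using norm_apply_le_inner[OF assms, of x] op_le_inner[OF unit_intervalD(3)[OF assms], of x]
    by (simp add: power2_norm_eq_inner)
  then show "norm (blinfun_apply b x) \<le> 1 * norm x" by (simp add: power_mono_iff)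
qed simp

lemma unit_interval_antisym:
  assumes "a \<in> unit_interval" "b \<in> unit_interval" "op_le a b" "op_le b a"
  shows "a = b"
proof -
  have d: "b - a \<in> unit_interval"
    using assms by (intro unit_interval_diff) (auto dest: unit_intervalD)
  have "(norm (blinfun_apply (b - a) x))\<^sup>2 \<le> 0" for x
  proof -
    have "inner x (blinfun_apply (b - a) x) \<le> 0"
      using op_le_inner[OF assms(4), of x] by (simp add: blinfun.diff_left inner_diff_right)
    then show ?thesis using norm_apply_le_inner[OF d, of x] by linarith
  qed
  then have "blinfun_apply (b - a) x = 0" for x by simp
  then have "b - a = 0" by (intro blinfun_eqI) simp
  then show ?thesis by simp
qed

lemma op_square_le_norm:
  assumes "a \<in> A" shows "op_le (adj a o\<^sub>L a) ((norm a)\<^sup>2 *\<^sub>R id_blinfun)"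
proof (rule op_leI)
  fix x
  have "inner x (blinfun_apply (adj a o\<^sub>L a) x) = (norm (blinfun_apply a x))\<^sup>2"
    using assms by (simp add: inner_adj_right bounded power2_norm_eq_inner)
  also have "\<dots> \<le> (norm a * norm x)\<^sup>2" by (intro power_mono norm_blinfun) auto
  finally show "inner x (blinfun_apply (adj a o\<^sub>L a) x)
      \<le> inner x (blinfun_apply ((norm a)\<^sup>2 *\<^sub>R id_blinfun) x)"
    by (simp add: blinfun.scaleR_left power_mult_distrib power2_norm_eq_inner)
qed (use assms in \<open>auto simp: adj_comp adj_scaleR\<close>)

end

section \<open>Positive functionals\<close>

lemma quadratic_discriminant_complex:
  fixes P Q :: real and z :: complex
  assumes nonneg: "\<And>c. 0 \<le> P + 2 * Re (c * z) + (cmod c)\<^sup>2 * Q"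
  shows "(cmod z)\<^sup>2 \<le> P * Q"
proof -
  have *: "0 \<le> P - 2 * t * (cmod z)\<^sup>2 + t\<^sup>2 * (cmod z)\<^sup>2 * Q" for t
  proof -
    have "Re (of_real (- t) * cnj z * z) = - t * (cmod z)\<^sup>2"
      unfolding cmod_power2 by (simp add: power2_eq_square algebra_simps)
    then show ?thesis
      using nonneg[of "of_real (- t) * cnj z"] by (simp add: norm_mult power_mult_distrib)
  qed
  show ?thesis
  proof (cases "Q > 0")
    case True
    with *[of "1 / Q"] show ?thesis by (simp add: power2_eq_square field_simps)
  next
    case False
    have P: "P \<ge> 0" using *[of 0] by simp
    have "z = 0"
    proof (rule ccontr)
      assume "z \<noteq> 0"
      then have z: "(cmod z)\<^sup>2 > 0" by simp
      define t where "t = (P + 1) / (2 * (cmod z)\<^sup>2)"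
      have "t\<^sup>2 * (cmod z)\<^sup>2 * Q \<le> 0"
        using False by (intro mult_nonneg_nonpos) auto
      moreover have "2 * t * (cmod z)\<^sup>2 = P + 1" using z by (simp add: t_def)
      ultimately show False using *[of t] by linarith
    qed
    moreover have "P * Q \<ge> 0"
    proof (rule ccontr)
      assume "\<not> P * Q \<ge> 0"
      then have "Q < 0" using P False by (metis less_eq_real_def mult_eq_0_iff not_less)
      then have "P + (1 + P / - Q) * Q < 0" using P by (simp add: field_simps)
      moreover have "0 \<le> P + (sqrt (1 + P / - Q))\<^sup>2 * Q"
        using nonneg[of "of_real (sqrt (1 + P / - Q))"] \<open>z = 0\<close> by simp
      moreover have "(sqrt (1 + P / - Q))\<^sup>2 = 1 + P / - Q"
        using P \<open>Q < 0\<close> by (intro real_sqrt_pow2) (simp add: divide_nonneg_neg)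
      ultimately show False by simp
    qed
    ultimately show ?thesis by simp
  qed
qed

locale linear_functional = vn_algebra A for A :: "('h::chilbert_space \<Rightarrow>\<^sub>L 'h) set" +
  fixes \<phi> :: "('h \<Rightarrow>\<^sub>L 'h) \<Rightarrow> complex"
  assumes add: "a \<in> A \<Longrightarrow> b \<in> A \<Longrightarrow> \<phi> (a + b) = \<phi> a + \<phi> b"
    and scale: "a \<in> A \<Longrightarrow> \<phi> (op_scale c a) = c * \<phi> a"
begin

lemma scaleR: "a \<in> A \<Longrightarrow> \<phi> (r *\<^sub>R a) = of_real r * \<phi> a"
  by (metis op_scale_of_real scale)

lemma diff: "a \<in> A \<Longrightarrow> b \<in> A \<Longrightarrow> \<phi> (a - b) = \<phi> a - \<phi> b"
  using add[of a "(-1) *\<^sub>R b"] scaleR[of b "-1"] scaleR_in[of b "-1"] by simp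

lemma zero [simp]: "\<phi> 0 = 0"
  using scaleR[of 0 0] by simp

end

locale positive_functional = linear_functional A \<phi>
  for A :: "('h::chilbert_space \<Rightarrow>\<^sub>L 'h) set" and \<phi> +
  assumes pos: "a \<in> A \<Longrightarrow> positive_op a \<Longrightarrow> \<phi> a \<in> \<real> \<and> 0 \<le> Re (\<phi> a)"
begin

lemma Im_pos: "a \<in> A \<Longrightarrow> positive_op a \<Longrightarrow> Im (\<phi> a) = 0"
  using pos[of a] by (simp add: complex_is_Real_iff)

lemma mono: "a \<in> A \<Longrightarrow> b \<in> A \<Longrightarrow> op_le a b \<Longrightarrow> Re (\<phi> a) \<le> Re (\<phi> b)"
  using pos[of "b - a"] diff[of b a] by (simp add: op_le_def)

lemma Re_square: "a \<in> A \<Longrightarrow> 0 \<le> Re (\<phi> (a o\<^sub>L adj a))" "a \<in> A \<Longrightarrow> 0 \<le> Re (\<phi> (adj a o\<^sub>L a))"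
  using pos positive_square positive_square' by auto

lemma sesquilinear_expansion:
  assumes "a \<in> A" "b \<in> A" "c \<in> A"
  shows "\<phi> ((b + op_scale k c) o\<^sub>L a o\<^sub>L adj (b + op_scale k c)) =
    \<phi> (b o\<^sub>L a o\<^sub>L adj b) + k * \<phi> (c o\<^sub>L a o\<^sub>L adj b) + cnj k * \<phi> (b o\<^sub>L a o\<^sub>L adj c)
      + k * cnj k * \<phi> (c o\<^sub>L a o\<^sub>L adj c)"
proof -
  have "(b + op_scale k c) o\<^sub>L a o\<^sub>L adj (b + op_scale k c) =
    (b o\<^sub>L a o\<^sub>L adj b) + op_scale k (c o\<^sub>L a o\<^sub>L adj b) + op_scale (cnj k) (b o\<^sub>L a o\<^sub>L adj c)
      + op_scale (k * cnj k) (c o\<^sub>L a o\<^sub>L adj c)"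
    using assms
    by (intro blinfun_eqI)
      (simp add: adj_add adj_op_scale blinfun.add_left blinfun.add_right blinfun_apply_op_scale
        apply_scaleC scaleC_scaleC scaleC_add_right)
  then show ?thesis using assms by (simp add: add scale)
qed

lemma hermitian_form:
  assumes "a \<in> A" "b \<in> A" "c \<in> A" "positive_op a"
  shows "\<phi> (c o\<^sub>L a o\<^sub>L adj b) = cnj (\<phi> (b o\<^sub>L a o\<^sub>L adj c))"
proof -
  have I: "Im (k * \<phi> (c o\<^sub>L a o\<^sub>L adj b) + cnj k * \<phi> (b o\<^sub>L a o\<^sub>L adj c)) = 0" for k
  proof -
    have "Im (\<phi> ((b + op_scale k c) o\<^sub>L a o\<^sub>L adj (b + op_scale k c))) = 0"
      "Im (\<phi> (b o\<^sub>L a o\<^sub>L adj b)) = 0" "Im (\<phi> (c o\<^sub>L a o\<^sub>L adj c)) = 0"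
      using assms by (auto intro!: Im_pos positive_conj)
    moreover have "Im (k * cnj k) = 0" by simp
    ultimately show ?thesis
      unfolding sesquilinear_expansion[OF assms(1-3)] by (simp del: complex_mult_cnj)
  qed
  show ?thesis using I[of 1] I[of \<i>] by (intro complex_eqI) simp_all
qed

lemma Cauchy_Schwarz_form:
  assumes "a \<in> A" "b \<in> A" "c \<in> A" "positive_op a"
  shows "(cmod (\<phi> (b o\<^sub>L a o\<^sub>L adj c)))\<^sup>2
    \<le> Re (\<phi> (b o\<^sub>L a o\<^sub>L adj b)) * Re (\<phi> (c o\<^sub>L a o\<^sub>L adj c))"
proof (rule quadratic_discriminant_complex)
  fix k
  let ?d = "b + op_scale (cnj k) c"
  have "0 \<le> Re (\<phi> (?d o\<^sub>L a o\<^sub>L adj ?d))"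
    using assms pos[OF _ positive_conj[of a ?d]] by auto
  moreover have "Im (\<phi> (c o\<^sub>L a o\<^sub>L adj c)) = 0"
    using assms by (auto intro!: Im_pos positive_conj)
  ultimately show "0 \<le> Re (\<phi> (b o\<^sub>L a o\<^sub>L adj b)) + 2 * Re (k * \<phi> (b o\<^sub>L a o\<^sub>L adj c))
      + (cmod k)\<^sup>2 * Re (\<phi> (c o\<^sub>L a o\<^sub>L adj c))"
    unfolding sesquilinear_expansion[OF assms(1-3)] hermitian_form[OF assms] cmod_power2
    by (simp add: power2_eq_square algebra_simps)
qed

lemma hermitian: "a \<in> A \<Longrightarrow> \<phi> (adj a) = cnj (\<phi> a)"
  using hermitian_form[of id_blinfun a id_blinfun] by simp

lemma Cauchy_Schwarz:
  "a \<in> A \<Longrightarrow> b \<in> A \<Longrightarrow>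
    (cmod (\<phi> (a o\<^sub>L b)))\<^sup>2 \<le> Re (\<phi> (a o\<^sub>L adj a)) * Re (\<phi> (adj b o\<^sub>L b))"
  using Cauchy_Schwarz_form[of id_blinfun a "adj b"] by simp

lemma square_le_norm: "a \<in> A \<Longrightarrow> Re (\<phi> (a o\<^sub>L adj a)) \<le> (norm a)\<^sup>2 * Re (\<phi> id_blinfun)"
  using mono[OF _ _ op_square_le_norm[of "adj a"]] by (simp add: scaleR)

lemma cmod_le_norm:
  assumes "a \<in> A" shows "cmod (\<phi> a) \<le> norm a * Re (\<phi> id_blinfun)"
proof (rule power2_le_imp_le)
  have 1: "0 \<le> Re (\<phi> id_blinfun)" using pos[of id_blinfun] by simp
  have "(cmod (\<phi> a))\<^sup>2 \<le> Re (\<phi> (a o\<^sub>L adj a)) * Re (\<phi> id_blinfun)"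
    using Cauchy_Schwarz[of a id_blinfun] assms by simp
  also have "\<dots> \<le> (norm a)\<^sup>2 * Re (\<phi> id_blinfun) * Re (\<phi> id_blinfun)"
    using square_le_norm[OF assms] 1 by (intro mult_right_mono)
  finally show "(cmod (\<phi> a))\<^sup>2 \<le> (norm a * Re (\<phi> id_blinfun))\<^sup>2"
    by (simp add: power2_eq_square algebra_simps)
  show "0 \<le> norm a * Re (\<phi> id_blinfun)" using 1 by simp
qed

text \<open>If \<open>x\<close> turns \<open>\<phi>\<close> into a positive functional, then so does \<open>x\<^sup>2\<close>, because the hermitian
  symmetry of \<open>\<phi> (x \<cdot>)\<close> turns \<open>\<phi> (x a x\<^sup>*)\<close> into \<open>\<phi> (x\<^sup>2 a)\<close>.  The Cauchy--Schwarz inequality then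
  gives \<open>\<phi> (x a)\<^sup>2 \<le> \<phi> (x\<^sup>2 a) \<phi> (a)\<close>.\<close>

lemma positive_twist_square:
  assumes x: "x \<in> A" and px: "positive_functional A (\<lambda>a. \<phi> (x o\<^sub>L a))"
    and a: "a \<in> A" "positive_op a"
  shows "\<phi> (x o\<^sub>L x o\<^sub>L a) = \<phi> (x o\<^sub>L a o\<^sub>L adj x)"
    "(Re (\<phi> (x o\<^sub>L a)))\<^sup>2 \<le> Re (\<phi> (x o\<^sub>L x o\<^sub>L a)) * Re (\<phi> a)"
proof -
  interpret x: positive_functional A "\<lambda>a. \<phi> (x o\<^sub>L a)" by fact
  have "\<phi> (x o\<^sub>L (a o\<^sub>L adj x)) = cnj (\<phi> (x o\<^sub>L (x o\<^sub>L a)))"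
    using x.hermitian[of "x o\<^sub>L a"] a x by (simp add: adj_comp positive_adj)
  moreover have "Im (\<phi> (x o\<^sub>L a o\<^sub>L adj x)) = 0" using a x by (auto intro!: Im_pos positive_conj)
  ultimately show *: "\<phi> (x o\<^sub>L x o\<^sub>L a) = \<phi> (x o\<^sub>L a o\<^sub>L adj x)"
    by (intro complex_eqI) (simp_all add: compose_assoc)
  have "(Re (\<phi> (x o\<^sub>L a)))\<^sup>2 \<le> (cmod (\<phi> (x o\<^sub>L a)))\<^sup>2" by (simp add: cmod_power2)
  also have "\<dots> \<le> Re (\<phi> (x o\<^sub>L a o\<^sub>L adj x)) * Re (\<phi> a)"
    using Cauchy_Schwarz_form[of a x id_blinfun] a x by simp
  finally show "(Re (\<phi> (x o\<^sub>L a)))\<^sup>2 \<le> Re (\<phi> (x o\<^sub>L x o\<^sub>L a)) * Re (\<phi> a)" using * by simp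
qed

lemma linear_twist: "x \<in> A \<Longrightarrow> linear_functional A (\<lambda>a. \<phi> (x o\<^sub>L a))"
  by unfold_locales (simp_all add: compose_distribs add op_scale_comp_right scale)

lemma positive_twist_compose:
  assumes x: "x \<in> A" and px: "positive_functional A (\<lambda>a. \<phi> (x o\<^sub>L a))"
  shows "positive_functional A (\<lambda>a. \<phi> (x o\<^sub>L x o\<^sub>L a))"
proof -
  interpret l: linear_functional A "\<lambda>a. \<phi> (x o\<^sub>L x o\<^sub>L a)" using x by (intro linear_twist) auto
  show ?thesis
    by unfold_locales
      (use assms in \<open>simp add: positive_twist_square(1) pos positive_conj\<close>)
qed

text \<open>Iterating the previous inequality along \<open>x, x\<^sup>2, x\<^sup>4, \<dots>\<close> yields
  \<open>(\<phi> (x a) / \<phi> (a)) ^ 2 ^ n \<le> \<phi> (x ^ 2 ^ n a) / \<phi> (a) \<le> const * \<parallel>x\<parallel> ^ 2 ^ n\<close>, which forces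
  \<open>\<phi> (x a) \<le> \<parallel>x\<parallel> \<phi> (a)\<close>.\<close>

lemma positive_twist_le:
  assumes x: "x \<in> A" and px: "positive_functional A (\<lambda>a. \<phi> (x o\<^sub>L a))"
    and a: "a \<in> A" "positive_op a"
  shows "Re (\<phi> (x o\<^sub>L a)) \<le> norm x * Re (\<phi> a)"
proof (rule ccontr)
  assume "\<not> ?thesis"
  then have gt: "norm x * Re (\<phi> a) < Re (\<phi> (x o\<^sub>L a))" by simp
  have a0: "0 \<le> Re (\<phi> a)" using pos a by simp
  then have gt0: "0 < Re (\<phi> (x o\<^sub>L a))"
    using gt by (meson mult_nonneg_nonneg norm_ge_zero order_le_less_trans)
  have apos: "0 < Re (\<phi> a)"
  proof (rule ccontr)
    assume "\<not> 0 < Re (\<phi> a)"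
    then have "Re (\<phi> a) = 0" using a0 by simp
    then show False using positive_twist_square(2)[OF x px a] gt0 by simp
  qed
  define X where "X = rec_nat x (\<lambda>_ y. y o\<^sub>L y)"
  have X0: "X 0 = x" and XS: "\<And>n. X (Suc n) = X n o\<^sub>L X n" by (simp_all add: X_def)
  have X: "X n \<in> A \<and> positive_functional A (\<lambda>a. \<phi> (X n o\<^sub>L a)) \<and> norm (X n) \<le> norm x ^ 2 ^ n"
    for n
  proof (induction n)
    case (Suc n)
    have "norm (X (Suc n)) \<le> norm (X n) * norm (X n)" by (simp add: XS norm_compose_le)
    also have "\<dots> \<le> norm x ^ 2 ^ n * norm x ^ 2 ^ n" using Suc by (intro mult_mono) auto
    finally have "norm (X (Suc n)) \<le> norm x ^ 2 ^ Suc n" by (simp add: mult_2 power_add)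
    then show ?case using Suc positive_twist_compose[of "X n"] by (simp add: XS)
  qed (use x px in \<open>simp add: X0\<close>)
  define t where "t n = Re (\<phi> (X n o\<^sub>L a)) / Re (\<phi> a)" for n
  have t: "t 0 ^ 2 ^ n \<le> t n" for n
  proof (induction n)
    case (Suc n)
    have "t 0 ^ 2 ^ Suc n = (t 0 ^ 2 ^ n)\<^sup>2" by (simp add: power_mult[symmetric] mult.commute)
    also have "\<dots> \<le> (t n)\<^sup>2"
      using Suc apos gt0 by (intro power_mono) (auto simp: t_def X0)
    also have "\<dots> \<le> t (Suc n)"
      using positive_twist_square(2)[of "X n" a] X[of n] a apos
      by (simp add: t_def XS power2_eq_square field_simps)
    finally show ?case .
  qed simp
  define M where "M = norm a * Re (\<phi> id_blinfun) / Re (\<phi> a)"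
  have M: "t n \<le> norm x ^ 2 ^ n * M" for n
  proof -
    have 1: "0 \<le> Re (\<phi> id_blinfun)" using pos[of id_blinfun] by simp
    have "Re (\<phi> (X n o\<^sub>L a)) \<le> cmod (\<phi> (X n o\<^sub>L a))" by (rule complex_Re_le_cmod)
    also have "\<dots> \<le> norm (X n o\<^sub>L a) * Re (\<phi> id_blinfun)" using X a by (intro cmod_le_norm) auto
    also have "\<dots> \<le> (norm x ^ 2 ^ n * norm a) * Re (\<phi> id_blinfun)"
      using X[of n] 1 norm_compose_le[of "X n" a]
      by (intro mult_right_mono order_trans[OF norm_compose_le]) auto
    finally show ?thesis using apos by (simp add: t_def M_def divide_right_mono mult.assoc)
  qed
  have lt: "norm x < t 0" using gt apos by (simp add: t_def X0 field_simps)
  show False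
  proof (cases "norm x = 0")
    case True
    then show False using M[of 0] lt by simp
  next
    case False
    define q where "q = t 0 / norm x"
    have q1: "q > 1" using False lt by (simp add: q_def)
    have "q ^ 2 ^ n \<le> M" for n
      using order_trans[OF t M, of n] False by (simp add: q_def power_divide field_simps)
    moreover obtain m where "M < q ^ m" using real_arch_pow[OF q1] by blast
    moreover have "q ^ m \<le> q ^ 2 ^ m" using q1 by (intro power_increasing) auto
    ultimately show False by (meson not_less order_less_le_trans)
  qed
qed

end

lemma state_iff:
  assumes "von_neumann_algebra A"
  shows "state A \<phi> \<longleftrightarrow> positive_functional A \<phi> \<and> \<phi> id_blinfun = 1"
  using assms
  by (auto simp: state_def positive_functional_def linear_functional_def vn_algebra_def
      linear_functional_axioms_def positive_functional_axioms_def)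

text \<open>For a positive functional below a multiple of a normal one, the gap \<open>\<psi> (b) - \<psi> (a)\<close> to the
  least upper bound is controlled by the gap of the normal one.\<close>

lemma normal_state_dominated:
  assumes vn: "von_neumann_algebra A" and \<phi>: "normal_state A \<phi>" and \<psi>: "state A \<psi>"
    and k: "k \<ge> 0" and le: "\<And>a. a \<in> A \<Longrightarrow> positive_op a \<Longrightarrow> Re (\<psi> a) \<le> k * Re (\<phi> a)"
  shows "normal_state A \<psi>"
  unfolding normal_state_def
proof (intro conjI allI impI \<psi>)
  fix D b assume D: "D \<subseteq> A" "\<forall>a\<in>D. self_adjoint a" "op_directed D" "op_lub A D b"
  interpret p: positive_functional A \<phi> using \<phi> state_iff[OF vn] by (simp add: normal_state_def)
  interpret q: positive_functional A \<psi> using \<psi> state_iff[OF vn] by simp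
  have b: "b \<in> A" "\<And>a. a \<in> D \<Longrightarrow> op_le a b" using D by (auto simp: op_lub_def)
  have ne: "D \<noteq> {}" using D by (simp add: op_directed_def)
  have sup: "Re (\<phi> b) = (SUP a\<in>D. Re (\<phi> a))" using \<phi> D by (simp add: normal_state_def)
  have ub: "Re (\<psi> a) \<le> Re (\<psi> b)" if "a \<in> D" for a using that D b by (intro q.mono) auto
  show "Re (\<psi> b) = (SUP a\<in>D. Re (\<psi> a))"
  proof (rule antisym)
    show "(SUP a\<in>D. Re (\<psi> a)) \<le> Re (\<psi> b)" using ne ub by (intro cSUP_least)
    show "Re (\<psi> b) \<le> (SUP a\<in>D. Re (\<psi> a))"
    proof (rule field_le_epsilon)
      fix e :: real assume e: "e > 0"
      have "Re (\<phi> b) - e / (k + 1) < (SUP a\<in>D. Re (\<phi> a))" using e k sup by simp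
      then obtain a where a: "a \<in> D" "Re (\<phi> b) - e / (k + 1) < Re (\<phi> a)"
        using ne less_cSUP_iff[of D "\<lambda>a. Re (\<phi> a)"] b D p.mono
        by (smt (verit, ccfv_threshold) bdd_above.I2 subsetD)
      have "Re (\<psi> b) - Re (\<psi> a) = Re (\<psi> (b - a))" using a D b by (auto simp: q.diff)
      also have "\<dots> \<le> k * Re (\<phi> (b - a))"
        using a D b by (intro le) (auto simp: op_le_def)
      also have "\<dots> = k * (Re (\<phi> b) - Re (\<phi> a))" using a D b by (auto simp: p.diff)
      also have "\<dots> \<le> k * (e / (k + 1))" using a k by (intro mult_left_mono) auto
      also have "\<dots> \<le> e" using e k by (simp add: field_simps)
      finally have "Re (\<psi> b) \<le> Re (\<psi> a) + e" by simp
      also have "Re (\<psi> a) \<le> (SUP a\<in>D. Re (\<psi> a))"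
        using a ub by (intro cSUP_upper bdd_above.I2)
      finally show "Re (\<psi> b) \<le> (SUP a\<in>D. Re (\<psi> a)) + e" by simp
    qed
  qed
qed

section \<open>Weak compactness\<close>

text \<open>Two coefficients at a time allow both inequalities for one coefficient and linear relations
  between two of them to be tested.\<close>

definition weakly_adherent :: "('h::chilbert_space \<Rightarrow>\<^sub>L 'h) filter \<Rightarrow> ('h \<Rightarrow>\<^sub>L 'h) \<Rightarrow> bool" where
  "weakly_adherent F d \<longleftrightarrow> (\<forall>\<xi> \<eta> \<xi>' \<eta>' S. closed S \<longrightarrow>
     eventually (\<lambda>a. inner \<xi> (blinfun_apply a \<eta>) + inner \<xi>' (blinfun_apply a \<eta>') \<in> S) F \<longrightarrow>
     inner \<xi> (blinfun_apply d \<eta>) + inner \<xi>' (blinfun_apply d \<eta>') \<in> S)"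

lemma weakly_adherentD:
  assumes "weakly_adherent F d" "closed S"
    "eventually (\<lambda>a. inner \<xi> (blinfun_apply a \<eta>) + inner \<xi>' (blinfun_apply a \<eta>') \<in> S) F"
  shows "inner \<xi> (blinfun_apply d \<eta>) + inner \<xi>' (blinfun_apply d \<eta>') \<in> S"
  using assms unfolding weakly_adherent_def by blast

context vn_algebra
begin

text \<open>Weak operator compactness of balls of \<open>A\<close>, for real matrix coefficients.  The matrix
  coefficients \<open>(\<xi>, \<eta>) \<mapsto> \<langle>\<xi>, a \<eta>\<rangle>\<close> live in a product of intervals, so Tychonoff's theorem gives a
  cluster point, and every closed condition on two coefficients that holds along the filter
  passes to it.  Such conditions express linearity and commutation with \<open>A'\<close>, so the cluster
  point comes from an operator in \<open>A'' = A\<close>.\<close>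

lemma weak_cluster_point:
  assumes "F \<noteq> bot" and ball: "eventually (\<lambda>a. a \<in> A \<and> norm a \<le> K) F"
  obtains d where "d \<in> A" "weakly_adherent F d"
proof -
  have K: "0 \<le> K"
    using eventually_happens'[OF \<open>F \<noteq> bot\<close> ball] norm_ge_zero order_trans by blast
  define E where "E a = (\<lambda>(\<xi>, \<eta>). inner \<xi> (blinfun_apply a \<eta>))" for a :: "'h \<Rightarrow>\<^sub>L 'h"
  define R where "R p = K * norm (fst p) * norm (snd p)" for p :: "'h \<times> 'h"
  define B where "B = (\<Pi>\<^sub>E p\<in>UNIV. {- R p..R p})"
  have "compactin (product_topology (\<lambda>_. euclidean) UNIV) B"
    unfolding B_def by (subst compactin_PiE) auto
  then have B: "compact B" by (simp add: euclidean_product_topology flip: compactin_euclidean_iff)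
  have EB: "E a \<in> B" if "norm a \<le> K" for a
  proof -
    have "\<bar>inner \<xi> (blinfun_apply a \<eta>)\<bar> \<le> K * norm \<xi> * norm \<eta>" for \<xi> \<eta>
    proof -
      have "\<bar>inner \<xi> (blinfun_apply a \<eta>)\<bar> \<le> norm \<xi> * norm (blinfun_apply a \<eta>)"
        by (rule Cauchy_Schwarz_ineq2)
      also have "\<dots> \<le> norm \<xi> * (K * norm \<eta>)"
        using that by (intro mult_left_mono order_trans[OF norm_blinfun] mult_right_mono) auto
      finally show ?thesis by (simp add: algebra_simps)
    qed
    then show ?thesis by (auto simp: B_def E_def R_def abs_le_iff) (smt (verit))
  qed
  have "filtermap E F \<noteq> bot" using \<open>F \<noteq> bot\<close> by (simp add: filtermap_bot_iff)
  moreover have "eventually (\<lambda>f. f \<in> B) (filtermap E F)"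
    using ball by (auto simp: eventually_filtermap EB elim: eventually_mono)
  ultimately obtain f where f: "f \<in> B" "inf (nhds f) (filtermap E F) \<noteq> bot"
    using B unfolding compact_filter by blast
  have fcl: "f \<in> C" if "closed C" "eventually (\<lambda>a. E a \<in> C) F" for C
  proof (rule ccontr)
    assume "f \<notin> C"
    then have "eventually (\<lambda>g. g \<in> - C) (nhds f)"
      using that by (intro eventually_nhds_in_open) auto
    moreover have "eventually (\<lambda>g. g \<in> C) (filtermap E F)" using that by (simp add: eventually_filtermap)
    ultimately have "eventually (\<lambda>_. False) (inf (nhds f) (filtermap E F))"
      by (subst eventually_inf) (metis ComplD)
    with f show False by (simp add: eventually_False)
  qed
  have two: "c * f p + c' * f p' + c'' * f p'' \<in> S"
    if "closed S" "eventually (\<lambda>a. c * E a p + c' * E a p' + c'' * E a p'' \<in> S) F"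
    for S c c' c'' p p' p''
  proof -
    have "closed ((\<lambda>g::('h \<times> 'h) \<Rightarrow> real. c * g p + c' * g p' + c'' * g p'') -` S)"
      by (intro continuous_closed_vimage that continuous_on_interior[where S=UNIV] continuous_intros
          continuous_on_product_coordinates)
    from fcl[OF this] that show ?thesis by simp
  qed
  have lin1: "f (c *\<^sub>R \<xi> + \<xi>', \<eta>) = c * f (\<xi>, \<eta>) + f (\<xi>', \<eta>)" for c \<xi> \<xi>' \<eta>
    using two[of "{0}" 1 "(c *\<^sub>R \<xi> + \<xi>', \<eta>)" "- c" "(\<xi>, \<eta>)" "-1" "(\<xi>', \<eta>)"]
    by (simp add: E_def inner_add_left)
  have lin2: "f (\<xi>, c *\<^sub>R \<eta> + \<eta>') = c * f (\<xi>, \<eta>) + f (\<xi>, \<eta>')" for c \<xi> \<eta>' \<eta>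
    using two[of "{0}" 1 "(\<xi>, c *\<^sub>R \<eta> + \<eta>')" "- c" "(\<xi>, \<eta>)" "-1" "(\<xi>, \<eta>')"]
    by (simp add: E_def inner_add_right blinfun.add_right blinfun.scaleR_right)
  have swap: "f (\<xi>, \<eta>) = f (\<xi>', \<eta>')"
    if "\<And>a. a \<in> A \<Longrightarrow> inner \<xi> (blinfun_apply a \<eta>) = inner \<xi>' (blinfun_apply a \<eta>')" for \<xi> \<eta> \<xi>' \<eta>'
  proof -
    have "eventually (\<lambda>a. E a (\<xi>, \<eta>) - E a (\<xi>', \<eta>') = 0) F"
      using ball by (rule eventually_mono) (simp add: E_def that)
    then show ?thesis using two[of "{0}" 1 "(\<xi>, \<eta>)" "-1" "(\<xi>', \<eta>')" 0 "(\<xi>, \<eta>)"] by simp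
  qed
  have bd: "\<bar>f (\<xi>, \<eta>)\<bar> \<le> K * norm \<xi> * norm \<eta>" for \<xi> \<eta>
    using PiE_mem[OF f(1)[unfolded B_def], of "(\<xi>, \<eta>)"] by (simp add: R_def abs_le_iff)
  have "bounded_linear (\<lambda>\<xi>. f (\<xi>, \<eta>))" for \<eta>
  proof (rule bounded_linear_intro[where K = "K * norm \<eta>"])
    show "f (x + y, \<eta>) = f (x, \<eta>) + f (y, \<eta>)" for x y using lin1[of 1 x y] by simp
    show "f (r *\<^sub>R x, \<eta>) = r *\<^sub>R f (x, \<eta>)" for r x
      using lin1[of r x 0 \<eta>] lin1[of 1 0 0 \<eta>] by simp
    show "norm (f (x, \<eta>)) \<le> norm x * (K * norm \<eta>)" for x using bd[of x \<eta>] by (simp add: ac_simps)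
  qed
  then have "\<exists>z. \<forall>\<xi>. f (\<xi>, \<eta>) = inner z \<xi>" for \<eta> by (rule riesz_real)
  then obtain D where D: "\<And>\<xi> \<eta>. inner (D \<eta>) \<xi> = f (\<xi>, \<eta>)" by metis
  have blD: "bounded_linear D"
  proof (rule bounded_linear_intro[where K = "K"])
    show "D (x + y) = D x + D y" for x y
      using lin2[of _ 1 x y] by (intro inner_left_eqI) (simp add: D inner_add_left)
    show "D (r *\<^sub>R x) = r *\<^sub>R D x" for r x
      using lin2[of _ r x 0] lin2[of _ 1 0 0] by (intro inner_left_eqI) (simp add: D)
    show "norm (D x) \<le> norm x * K" for x
    proof -
      have "norm (D x) * norm (D x) = f (D x, x)"
        using D[of x "D x"] by (simp add: power2_norm_eq_inner flip: power2_eq_square)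
      also have "\<dots> \<le> (norm x * K) * norm (D x)" using bd[of "D x" x] by (simp add: ac_simps)
      finally show ?thesis
        using K by (cases "norm (D x) = 0") auto
    qed
  qed
  define d where "d = Blinfun D"
  have d: "inner \<xi> (blinfun_apply d \<eta>) = f (\<xi>, \<eta>)" for \<xi> \<eta>
    using D[of \<eta> \<xi>] by (simp add: d_def bounded_linear_Blinfun_apply[OF blD] inner_commute)
  have dB: "d \<in> bounded_ops"
    unfolding bounded_ops_def
  proof (intro CollectI allI inner_left_eqI)
    fix c \<eta> \<xi>
    have "f (\<xi>, c *\<^sub>C \<eta>) = f (cnj c *\<^sub>C \<xi>, \<eta>)"
      by (rule swap) (simp add: apply_scaleC inner_scaleC_left)
    then show "inner (blinfun_apply d (c *\<^sub>C \<eta>)) \<xi> = inner (c *\<^sub>C blinfun_apply d \<eta>) \<xi>"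
      by (metis d inner_commute inner_scaleC_left complex_cnj_cnj)
  qed
  have "d \<in> commutant (commutant A)"
    unfolding commutant_def[of "commutant A"]
  proof (intro CollectI conjI dB ballI blinfun_eqI inner_left_eqI)
    fix t \<eta> \<xi> assume t: "t \<in> commutant A"
    then have tB: "t \<in> bounded_ops" by (simp add: commutant_def)
    have "f (blinfun_apply (adj t) \<xi>, \<eta>) = f (\<xi>, blinfun_apply t \<eta>)" 
    proof (rule swap)
      fix a assume "a \<in> A"
      then have "a o\<^sub>L t = t o\<^sub>L a" using t by (simp add: commutant_def)
      then have "blinfun_apply a (blinfun_apply t \<eta>) = blinfun_apply t (blinfun_apply a \<eta>)"
        by (metis blinfun_apply_blinfun_compose)
      then show "inner (blinfun_apply (adj t) \<xi>) (blinfun_apply a \<eta>) = inner \<xi> (blinfun_apply a (blinfun_apply t \<eta>))"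
        by (simp add: inner_adj tB)
    qed
    then show "inner (blinfun_apply (t o\<^sub>L d) \<eta>) \<xi> = inner (blinfun_apply (d o\<^sub>L t) \<eta>) \<xi>"
      by (metis blinfun_apply_blinfun_compose d inner_commute inner_adj tB)
  qed
  then have "d \<in> A" by (simp add: bicommutant)
  moreover have "weakly_adherent F d"
    unfolding weakly_adherent_def
  proof (intro allI impI)
    fix \<xi> \<eta> \<xi>' \<eta>' and S :: "real set"
    assume "closed S"
      "eventually (\<lambda>a. inner \<xi> (blinfun_apply a \<eta>) + inner \<xi>' (blinfun_apply a \<eta>') \<in> S) F"
    then show "inner \<xi> (blinfun_apply d \<eta>) + inner \<xi>' (blinfun_apply d \<eta>') \<in> S"
      using two[of S 1 "(\<xi>, \<eta>)" 1 "(\<xi>', \<eta>')" 0 "(\<xi>, \<eta>)"] by (simp add: d E_def)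
  qed
  ultimately show thesis by (rule that)
qed

text \<open>Vigier's theorem for the unit interval: the cluster point of an increasing net is its least
  upper bound, since all the inequalities involved are closed conditions.\<close>

lemma directed_lub:
  assumes D: "D \<subseteq> unit_interval" "op_directed D"
  obtains b where "b \<in> unit_interval" "op_lub A D b"
    and "\<And>\<xi> k. (\<And>a. a \<in> D \<Longrightarrow> inner \<xi> (blinfun_apply a \<xi>) \<le> k) \<Longrightarrow> inner \<xi> (blinfun_apply b \<xi>) \<le> k"
proof -
  have DA: "a \<in> A" "adj a = a" "positive_op a" if "a \<in> D" for a using that D unit_intervalD by auto
  have ne: "D \<noteq> {}" using D by (simp add: op_directed_def)
  define F where "F = (INF a\<in>D. principal {c \<in> D. op_le a c})"
  have ev: "eventually P F \<longleftrightarrow> (\<exists>a\<in>D. \<forall>c\<in>D. op_le a c \<longrightarrow> P c)" for P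
    unfolding F_def
  proof (subst eventually_INF_base[OF ne])
    fix a b assume ab: "a \<in> D" "b \<in> D"
    have "\<exists>c\<in>D. op_le a c \<and> op_le b c" using D(2) ab by (simp add: op_directed_def)
    then obtain c where c: "c \<in> D" "op_le a c" "op_le b c" by blast
    then show "\<exists>x\<in>D. principal {c \<in> D. op_le x c}
        \<le> inf (principal {c \<in> D. op_le a c}) (principal {c \<in> D. op_le b c})"
      using ab DA by (intro bexI[of _ c]) (auto intro: op_le_trans[of _ c])
  qed (auto simp: eventually_principal)
  have "\<not> eventually (\<lambda>_. False) F" unfolding ev using op_le_refl by blast
  then have "F \<noteq> bot" by (simp add: eventually_False)
  moreover have "eventually (\<lambda>a. a \<in> A \<and> norm a \<le> 1) F"
    unfolding ev using ne D unit_intervalD(1) unit_interval_norm_le by blast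
  ultimately obtain b where b: "b \<in> A" and cl: "weakly_adherent F b"
    by (rule weak_cluster_point)
  note cl = weakly_adherentD[OF cl]
  have upper: "inner \<xi> (blinfun_apply b \<xi>) \<le> k"
    if "\<And>a. a \<in> D \<Longrightarrow> inner \<xi> (blinfun_apply a \<xi>) \<le> k" for \<xi> k
    using cl[of "{..k}" \<xi> \<xi> 0 0] that ne by (auto simp: ev)
  have lower: "inner \<xi> (blinfun_apply a \<xi>) \<le> inner \<xi> (blinfun_apply b \<xi>)" if "a \<in> D" for a \<xi>
    using cl[of "{inner \<xi> (blinfun_apply a \<xi>)..}" \<xi> \<xi> 0 0] that op_le_inner by (auto simp: ev)
  have sa: "adj b = b"
  proof (rule adj_eqI)
    fix x y
    have "inner x (blinfun_apply b y) + inner (- y) (blinfun_apply b x) \<in> {0}"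
    proof (rule cl)
      show "eventually (\<lambda>a. inner x (blinfun_apply a y) + inner (- y) (blinfun_apply a x) \<in> {0}) F"
      proof -
        have "inner x (blinfun_apply a y) + inner (- y) (blinfun_apply a x) = 0" if "a \<in> D" for a
          using inner_adj[OF bounded[OF DA(1)[OF that]], of x y] DA(2)[OF that]
          by (simp add: inner_commute)
        then show ?thesis unfolding ev using ne by auto
      qed
    qed simp
    then show "inner (blinfun_apply b x) y = inner x (blinfun_apply b y)" by (simp add: inner_commute)
  qed (simp add: b bounded)
  have "op_le a b" if "a \<in> D" for a using that DA lower b sa by (intro op_leI) auto
  moreover have "op_le b c" if "c \<in> A" "self_adjoint c" "\<forall>a\<in>D. op_le a c" for c
    using that b sa by (intro op_leI upper) (auto simp: self_adjoint_def op_le_inner)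
  ultimately have lub: "op_lub A D b" using b sa by (auto simp: op_lub_def self_adjoint_def bounded)
  obtain a where a: "a \<in> D" using ne by auto
  have "positive_op b"
    using lower[OF a] positive_inner[OF DA(3)[OF a]] order_trans b sa by (intro positiveI) blast+
  moreover have "op_le b id_blinfun"
    using lub D unit_intervalD(3) positive_self_adjoint[OF positive_id] id_in
    unfolding op_lub_def by blast
  ultimately have "b \<in> unit_interval" using b by (simp add: unit_interval_def)
  then show thesis using lub upper by (rule that)
qed

text \<open>Zorn's lemma.  The last premise of the chain condition records that the least upper bound is also
  a weak limit, so that sets defined by vector functionals qualify.\<close>

lemma maximal_in_unit_interval:
  assumes S: "S \<subseteq> unit_interval" "S \<noteq> {}"
    and chain: "\<And>D b. D \<subseteq> S \<Longrightarrow> op_directed D \<Longrightarrow> b \<in> unit_interval \<Longrightarrow> op_lub A D b \<Longrightarrow>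
      (\<And>\<xi> k. (\<And>a. a \<in> D \<Longrightarrow> inner \<xi> (blinfun_apply a \<xi>) \<le> k) \<Longrightarrow> inner \<xi> (blinfun_apply b \<xi>) \<le> k)
      \<Longrightarrow> b \<in> S"
  shows "\<exists>m\<in>S. \<forall>a\<in>S. op_le m a \<longrightarrow> a = m"
proof -
  have SA: "a \<in> A" if "a \<in> S" for a using S that unit_intervalD by auto
  show ?thesis
  proof (rule predicate_Zorn)
    show "partial_order_on S (relation_of op_le S)"
    proof (rule partial_order_on_relation_ofI)
      show "op_le a c" if "a \<in> S" "b \<in> S" "c \<in> S" "op_le a b" "op_le b c" for a b c
        using that SA op_le_trans by blast
      show "a = b" if "a \<in> S" "b \<in> S" "op_le a b" "op_le b a" for a b
        using that S unit_interval_antisym by blast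
    qed simp
  next
    fix C assume C: "C \<in> Chains (relation_of op_le S)"
    then have CS: "C \<subseteq> S" and tot: "\<And>a b. a \<in> C \<Longrightarrow> b \<in> C \<Longrightarrow> op_le a b \<or> op_le b a"
      by (auto simp: Chains_def relation_of_def)
    show "\<exists>u\<in>S. \<forall>a\<in>C. op_le a u"
    proof (cases "C = {}")
      case True
      then show ?thesis using S by auto
    next
      case False
      then have dir: "op_directed C" unfolding op_directed_def using tot op_le_refl by blast
      obtain b where "b \<in> unit_interval" "op_lub A C b"
        "\<And>\<xi> k. (\<And>a. a \<in> C \<Longrightarrow> inner \<xi> (blinfun_apply a \<xi>) \<le> k) \<Longrightarrow> inner \<xi> (blinfun_apply b \<xi>) \<le> k"
        using directed_lub[of C] CS S dir by blast
      then show ?thesis using chain[OF CS dir] by (auto simp: op_lub_def)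
    qed
  qed
qed

end

section \<open>Normal functionals and weak limits\<close>

text \<open>The explicit rate gives the Cauchy estimates when a distance is controlled by the defect of
  \<open>q\<close> at a midpoint, as in the Riesz representation and in the search for an invariant state.\<close>

lemma minimizing_sequence:
  fixes q :: "'a \<Rightarrow> real"
  assumes ne: "C \<noteq> {}" and bdd: "bdd_below (q ` C)"
  obtains m u where "\<And>n::nat. u n \<in> C" "\<And>x. x \<in> C \<Longrightarrow> m \<le> q x" "\<And>n. q (u n) < m + 1 / Suc n"
proof -
  have "\<exists>x\<in>C. q x < Inf (q ` C) + 1 / Suc n" for n :: nat
    using cInf_lessD[of "q ` C" "Inf (q ` C) + 1 / Suc n"] ne by auto
  then obtain u where "\<And>n::nat. u n \<in> C \<and> q (u n) < Inf (q ` C) + 1 / Suc n" by metis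
  then show thesis using that[of u "Inf (q ` C)"] bdd by (auto intro: cInf_lower)
qed

lemma small_of_inverse_Suc:
  assumes "e > (0::real)" obtains N :: nat where "\<And>i. i \<ge> N \<Longrightarrow> 1 / real (Suc i) < e"
proof -
  obtain N where N: "1 / real (Suc N) < e" using assms nat_approx_posE by blast
  have "1 / real (Suc i) < e" if "i \<ge> N" for i
  proof -
    have "1 / real (Suc i) \<le> 1 / real (Suc N)" using that by (simp add: frac_le)
    then show ?thesis using N by linarith
  qed
  then show thesis by (rule that)
qed

text \<open>The Riesz representation along a linear parametrisation \<open>T\<close> of a subspace, which spares extending
  the functional to the whole space.  The images of a minimising sequence of
  \<open>\<parallel>T a\<parallel>\<^sup>2 - 2 f (a)\<close> converge to the representing vector.\<close>

lemma riesz_along: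
  fixes f :: "'b::real_vector \<Rightarrow> real" and T :: "'b \<Rightarrow> 'h::{real_inner, complete_space}"
  assumes S: "subspace S"
    and f_add: "\<And>a b. a \<in> S \<Longrightarrow> b \<in> S \<Longrightarrow> f (a + b) = f a + f b"
    and f_scale: "\<And>r a. a \<in> S \<Longrightarrow> f (r *\<^sub>R a) = r * f a"
    and T: "linear T" and le: "\<And>a. a \<in> S \<Longrightarrow> \<bar>f a\<bar> \<le> K * norm (T a)"
  obtains z where "\<And>a. a \<in> S \<Longrightarrow> f a = inner z (T a)"
proof -
  interpret T: linear T by fact
  define q where "q a = (norm (T a))\<^sup>2 - 2 * f a" for a
  have low: "- K\<^sup>2 \<le> q a" if "a \<in> S" for a
  proof -
    have "0 \<le> (norm (T a) - K)\<^sup>2" by simp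
    then show ?thesis using le[OF that] unfolding q_def power2_diff by (simp add: algebra_simps abs_le_iff)
  qed
  have "S \<noteq> {}" using S subspace_0 by auto
  moreover have "bdd_below (q ` S)" using low by (intro bdd_belowI[of _ "- K\<^sup>2"]) auto
  ultimately obtain m u where u: "\<And>n::nat. u n \<in> S"
    and m: "\<And>x. x \<in> S \<Longrightarrow> m \<le> q x" and um: "\<And>n. q (u n) < m + 1 / Suc n"
    using minimizing_sequence by metis
  have par: "(norm (T x - T y))\<^sup>2 = 2 * q x + 2 * q y - 4 * q ((1/2) *\<^sub>R (x + y))"
    if "x \<in> S" "y \<in> S" for x y
    using that S
    by (simp add: q_def power2_norm_eq_inner f_scale f_add T.add T.scaleR subspace_add subspace_scale
        inner_commute algebra_simps)
  have "Cauchy (\<lambda>n. T (u n))"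
  proof (rule CauchyI)
    fix e :: real assume e: "e > 0"
    obtain N where N: "\<And>i. i \<ge> N \<Longrightarrow> 1 / real (Suc i) < e\<^sup>2 / 4"
      using small_of_inverse_Suc[of "e\<^sup>2 / 4"] e by auto
    have "norm (T (u i) - T (u j)) < e" if "i \<ge> N" "j \<ge> N" for i j
    proof -
      have "(1/2) *\<^sub>R (u i + u j) \<in> S" using S u by (intro subspace_scale subspace_add)
      then have "(norm (T (u i) - T (u j)))\<^sup>2 < e\<^sup>2"
        using par[OF u u, of i j] um[of i] um[of j] N[OF that(1)] N[OF that(2)] m by fastforce
      then show ?thesis using e by (simp add: power_less_imp_less_base)
    qed
    then show "\<exists>N. \<forall>i\<ge>N. \<forall>j\<ge>N. norm (T (u i) - T (u j)) < e" by blast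
  qed
  then obtain z where z: "(\<lambda>n. T (u n)) \<longlonglongrightarrow> z" using Cauchy_convergent convergent_def by blast
  have "f x = inner z (T x)" if x: "x \<in> S" for x
  proof -
    define s where "s = inner z (T x) - f x"
    have lim: "(\<lambda>n. inner (T (u n)) (T x) - f x) \<longlonglongrightarrow> s"
      unfolding s_def by (intro tendsto_intros z)
    have "0 \<le> 2 * t * s + t\<^sup>2 * (norm (T x))\<^sup>2" for t
    proof -
      have "(\<lambda>n. 1 / real (Suc n) + 2 * t * (inner (T (u n)) (T x) - f x) + t\<^sup>2 * (norm (T x))\<^sup>2)
          \<longlonglongrightarrow> 0 + 2 * t * s + t\<^sup>2 * (norm (T x))\<^sup>2"
        by (intro tendsto_intros lim LIMSEQ_Suc[OF lim_1_over_n])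
      moreover have "0 \<le> 1 / real (Suc n) + 2 * t * (inner (T (u n)) (T x) - f x) + t\<^sup>2 * (norm (T x))\<^sup>2"
        for n
      proof -
        have "m \<le> q (u n + t *\<^sub>R x)" using S u x by (intro m subspace_add subspace_scale)
        also have "\<dots> = q (u n) + 2 * t * (inner (T (u n)) (T x) - f x) + t\<^sup>2 * (norm (T x))\<^sup>2"
          using S u x by (simp add: q_def power2_norm_eq_inner f_scale f_add T.add T.scaleR
              subspace_scale inner_commute algebra_simps power2_eq_square[of t])
        finally show ?thesis using um[of n] by linarith
      qed
      ultimately show ?thesis using LIMSEQ_le_const by fastforce
    qed
    note t = this
    define P where "P = (norm (T x))\<^sup>2 + 1"
    have P: "P > 0" by (simp add: P_def add_nonneg_pos)
    have "0 \<le> 2 * (- s / P) * s + (- s / P)\<^sup>2 * (norm (T x))\<^sup>2" by (rule t)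
    also have "\<dots> \<le> 2 * (- s / P) * s + (- s / P)\<^sup>2 * P"
      by (intro add_left_mono mult_left_mono) (auto simp: P_def)
    also have "\<dots> = - (s\<^sup>2 / P)" using P by (simp add: power2_eq_square field_simps)
    finally have "s\<^sup>2 \<le> 0" using P by (simp add: divide_le_0_iff)
    then show ?thesis by (simp add: s_def)
  qed
  then show thesis by (rule that)
qed

context positive_functional
begin

text \<open>Domination is asked for on \<open>[0, b]\<close> only: a normal functional need not be below a vector
  functional globally, but it is so locally.\<close>

definition vector_dominated :: "('h \<Rightarrow>\<^sub>L 'h) \<Rightarrow> bool" where
  "vector_dominated b \<longleftrightarrow> b \<in> unit_interval \<and>
     (\<exists>\<xi>. \<forall>c\<in>A. positive_op c \<longrightarrow> op_le c b \<longrightarrow> Re (\<phi> c) \<le> inner \<xi> (blinfun_apply c \<xi>))"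

text \<open>Choose \<open>\<xi>\<close> with
  \<open>\<phi> (e) < \<langle>\<xi>, e \<xi>\<rangle>\<close> and take away from \<open>e\<close> a maximal \<open>m \<le> e\<close> with \<open>\<phi> (m) \<ge> \<langle>\<xi>, m \<xi>\<rangle>\<close>; on what
  is left, maximality forces \<open>\<phi> (c) < \<langle>\<xi>, c \<xi>\<rangle>\<close>.\<close>

lemma vector_dominated_exists:
  assumes e: "e \<in> unit_interval" "e \<noteq> 0"
  obtains b where "vector_dominated b" "b \<noteq> 0" "op_le b e"
proof -
  note eA = unit_intervalD[OF e(1)]
  obtain v where v: "0 < inner v (blinfun_apply e v)"
  proof (rule ccontr)
    assume "\<not> thesis"
    then have "inner v (blinfun_apply e v) \<le> 0" for v using that not_less by blast
    then have "(norm (blinfun_apply e v))\<^sup>2 \<le> 0" for v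
      using norm_apply_le_inner[OF e(1), of v] order_trans by blast
    then have "e = 0" by (intro blinfun_eqI) simp
    with e show False by simp
  qed
  define s where "s = (Re (\<phi> e) + 1) / inner v (blinfun_apply e v)"
  have "0 \<le> s" using v pos[OF eA(1,2)] by (simp add: s_def)
  define \<xi> where "\<xi> = sqrt s *\<^sub>R v"
  have "inner \<xi> (blinfun_apply e \<xi>) = Re (\<phi> e) + 1"
    using \<open>0 \<le> s\<close> v
    by (simp add: \<xi>_def blinfun.scaleR_right flip: mult.assoc) (simp add: s_def)
  then have gt: "Re (\<phi> e) < inner \<xi> (blinfun_apply e \<xi>)" by simp
  define S where "S = {a \<in> A. positive_op a \<and> op_le a e \<and> inner \<xi> (blinfun_apply a \<xi>) \<le> Re (\<phi> a)}"
  have "\<exists>m\<in>S. \<forall>a\<in>S. op_le m a \<longrightarrow> a = m"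
  proof (rule maximal_in_unit_interval)
    show "S \<subseteq> unit_interval" using e unit_interval_le by (auto simp: S_def)
    have "op_le 0 e" using eA by (simp add: op_le_def)
    then have "0 \<in> S" by (simp add: S_def)
    then show "S \<noteq> {}" by auto
  next
    fix D b assume D: "D \<subseteq> S" "op_directed D" and b: "b \<in> unit_interval" "op_lub A D b"
      and wk: "\<And>\<xi> k. (\<And>a. a \<in> D \<Longrightarrow> inner \<xi> (blinfun_apply a \<xi>) \<le> k) \<Longrightarrow> inner \<xi> (blinfun_apply b \<xi>) \<le> k"
    have "inner \<xi> (blinfun_apply b \<xi>) \<le> Re (\<phi> b)"
    proof (rule wk)
      fix a assume a: "a \<in> D"
      then have "inner \<xi> (blinfun_apply a \<xi>) \<le> Re (\<phi> a)" "a \<in> A" using D by (auto simp: S_def)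
      moreover have "op_le a b" using a b by (auto simp: op_lub_def)
      ultimately show "inner \<xi> (blinfun_apply a \<xi>) \<le> Re (\<phi> b)"
        using mono[of a b] unit_intervalD(1)[OF b(1)] by linarith
    qed
    moreover have "op_le b e"
    proof -
      have "\<forall>a\<in>D. op_le a e" using D(1) by (auto simp: S_def)
      then show ?thesis using b(2) eA(1) positive_self_adjoint[OF eA(2)]
        unfolding op_lub_def by blast
    qed
    ultimately show "b \<in> S" using unit_intervalD[OF b(1)] by (simp add: S_def)
  qed
  then obtain m where m: "m \<in> S" "\<And>a. a \<in> S \<Longrightarrow> op_le m a \<Longrightarrow> a = m" by blast
  have mS: "m \<in> A" "positive_op m" "op_le m e" "inner \<xi> (blinfun_apply m \<xi>) \<le> Re (\<phi> m)"
    using m by (auto simp: S_def)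
  define b where "b = e - m"
  have b: "b \<in> unit_interval" using e mS by (simp add: b_def unit_interval_diff)
  have "Re (\<phi> c) \<le> inner \<xi> (blinfun_apply c \<xi>)" if c: "c \<in> A" "positive_op c" "op_le c b" for c
  proof (cases "c = 0")
    case False
    have "op_le m (m + c)" using c by (simp add: op_le_def)
    then have "m + c \<notin> S" using m(2) False by fastforce
    moreover have "op_le (m + c) e" using c by (simp add: op_le_def b_def algebra_simps)
    ultimately have "Re (\<phi> (m + c)) < inner \<xi> (blinfun_apply (m + c) \<xi>)"
      using c mS positive_add by (auto simp: S_def)
    then show ?thesis using mS c by (simp add: add blinfun.add_left inner_add_right)
  qed simp
  then have "vector_dominated b" using b by (auto simp: vector_dominated_def)
  moreover have "b \<noteq> 0" using gt mS by (auto simp: b_def)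
  moreover have "op_le b e" using mS by (simp add: b_def op_le_def)
  ultimately show thesis by (rule that)
qed

text \<open>The Cauchy--Schwarz inequality reduces the bound to \<open>\<phi> (b a\<^sup>* a b)\<close>, and \<open>b a\<^sup>* a b\<close> lies below a
  multiple of \<open>b\<close>, where the vector functional dominates.\<close>

lemma vector_dominated_bound:
  assumes b: "vector_dominated b"
  obtains v where "\<And>a. a \<in> A \<Longrightarrow>
    cmod (\<phi> (a o\<^sub>L b)) \<le> sqrt (Re (\<phi> id_blinfun)) * norm (blinfun_apply a v)"
proof -
  obtain \<xi> where bu: "b \<in> unit_interval"
    and \<xi>: "\<And>c. c \<in> A \<Longrightarrow> positive_op c \<Longrightarrow> op_le c b \<Longrightarrow> Re (\<phi> c) \<le> inner \<xi> (blinfun_apply c \<xi>)"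
    using b by (auto simp: vector_dominated_def)
  note bA = unit_intervalD[OF bu]
  have "cmod (\<phi> (a o\<^sub>L b)) \<le> sqrt (Re (\<phi> id_blinfun)) * norm (blinfun_apply a (blinfun_apply b \<xi>))"
    if a: "a \<in> A" for a
  proof -
    define k where "k = (norm a)\<^sup>2 + 1"
    have k: "k > 0" by (simp add: k_def add_nonneg_pos)
    define c where "c = adj (a o\<^sub>L b) o\<^sub>L (a o\<^sub>L b)"
    have c: "c \<in> A" "positive_op c" using a bA positive_square by (auto simp: c_def)
    have cx: "inner x (blinfun_apply c x) = (norm (blinfun_apply a (blinfun_apply b x)))\<^sup>2" for x
      using a bA by (simp add: c_def inner_adj_right bounded power2_norm_eq_inner)
    \<comment> \<open>\<open>b a\<^sup>* a b \<le> k b\<^sup>2 \<le> k b\<close>\<close>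
    have "op_le ((1 / k) *\<^sub>R c) b"
    proof (rule op_leI)
      fix x
      have "(norm (blinfun_apply a (blinfun_apply b x)))\<^sup>2 \<le> (norm a * norm (blinfun_apply b x))\<^sup>2"
        by (intro power_mono norm_blinfun) auto
      also have "\<dots> \<le> k * (norm (blinfun_apply b x))\<^sup>2"
        by (simp add: k_def power_mult_distrib algebra_simps)
      also have "\<dots> \<le> k * inner x (blinfun_apply b x)"
        using norm_apply_le_inner[OF bu] k by (intro mult_left_mono) auto
      finally show "inner x (blinfun_apply ((1 / k) *\<^sub>R c) x) \<le> inner x (blinfun_apply b x)"
        using k by (simp add: blinfun.scaleR_left cx field_simps)
    qed (use c bA in \<open>auto simp: adj_scaleR positive_adj\<close>)
    then have "Re (\<phi> ((1 / k) *\<^sub>R c)) \<le> inner \<xi> (blinfun_apply ((1 / k) *\<^sub>R c) \<xi>)"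
      using c k by (intro \<xi>) (auto intro: positive_scaleR)
    then have "Re (\<phi> c) \<le> inner \<xi> (blinfun_apply c \<xi>)"
      using k c by (simp add: scaleR blinfun.scaleR_left divide_le_cancel)
    then have "(cmod (\<phi> (a o\<^sub>L b)))\<^sup>2 \<le> Re (\<phi> id_blinfun) * (norm (blinfun_apply a (blinfun_apply b \<xi>)))\<^sup>2"
      using Cauchy_Schwarz[of id_blinfun "a o\<^sub>L b"] a bA pos[of id_blinfun]
      by (simp add: c_def[symmetric] cx) (meson mult_left_mono order_trans)
    then have "sqrt ((cmod (\<phi> (a o\<^sub>L b)))\<^sup>2) \<le> sqrt (Re (\<phi> id_blinfun) * (norm (blinfun_apply a (blinfun_apply b \<xi>)))\<^sup>2)"
      by (rule real_sqrt_le_mono)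
    then show ?thesis by (simp add: real_sqrt_mult)
  qed
  then show thesis by (rule that)
qed

text \<open>Being bounded in \<open>\<parallel>a v\<parallel>\<close> gives strong continuity in \<open>a\<close> only; the Riesz representation upgrades it
  to the weak continuity that cluster points respect.\<close>

lemma vector_dominated_coefficient:
  assumes b: "vector_dominated b"
  obtains v z where "\<And>a. a \<in> A \<Longrightarrow> Re (\<phi> (a o\<^sub>L b)) = inner z (blinfun_apply a v)"
proof -
  have bA: "b \<in> A" using b by (auto simp: vector_dominated_def dest: unit_intervalD)
  obtain v where v: "\<And>a. a \<in> A \<Longrightarrow>
      cmod (\<phi> (a o\<^sub>L b)) \<le> sqrt (Re (\<phi> id_blinfun)) * norm (blinfun_apply a v)"
    using vector_dominated_bound[OF b] by blast
  obtain z where "\<And>a. a \<in> A \<Longrightarrow> Re (\<phi> (a o\<^sub>L b)) = inner z (blinfun_apply a v)"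
  proof (rule riesz_along[of A "\<lambda>a. Re (\<phi> (a o\<^sub>L b))" "\<lambda>a. blinfun_apply a v"])
    show "subspace A" by (simp add: subspace_def)
    show "linear (\<lambda>a. blinfun_apply a v)"
      by (rule linearI) (simp_all add: blinfun.add_left blinfun.scaleR_left)
    show "\<bar>Re (\<phi> (a o\<^sub>L b))\<bar> \<le> sqrt (Re (\<phi> id_blinfun)) * norm (blinfun_apply a v)" if "a \<in> A" for a
      using v[OF that] abs_Re_le_cmod order_trans by blast
  qed (use bA in \<open>simp_all add: compose_distribs add scaleR\<close>)
  then show thesis by (rule that)
qed

end

text \<open>Normality makes the set of \<open>b\<close> with \<open>\<omega> (b) = 0\<close> closed under increasing limits,
  because \<open>\<omega>\<close> is continuous in the seminorm \<open>\<phi> (c\<^sup>* c)\<close> and \<open>(b - a)\<^sup>2 \<le> b - a\<close>.  A maximal such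
  \<open>b\<close> is \<open>1\<close>, since otherwise \<open>1 - b\<close> dominates a nonzero vector dominated element.\<close>

lemma vanishing_by_exhaustion:
  assumes vn: "von_neumann_algebra A" and \<phi>: "normal_state A \<phi>"
    and \<omega>: "linear_functional A \<omega>"
    and cont: "\<And>c. c \<in> A \<Longrightarrow> (cmod (\<omega> c))\<^sup>2 \<le> K * Re (\<phi> (adj c o\<^sub>L c))"
    and dom: "\<And>b. positive_functional.vector_dominated A \<phi> b \<Longrightarrow> \<omega> b = 0"
  shows "\<omega> id_blinfun = 0"
proof -
  interpret positive_functional A \<phi> using \<phi> state_iff[OF vn] by (simp add: normal_state_def)
  interpret x: linear_functional A \<omega> by fact
  have K: "K \<ge> 0"
    using cont[of id_blinfun] \<phi> by (simp add: normal_state_def state_def) (metis order_trans zero_le_power2)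
  define S where "S = {b \<in> unit_interval. \<omega> b = 0}"
  have "\<exists>m\<in>S. \<forall>a\<in>S. op_le m a \<longrightarrow> a = m"
  proof (rule maximal_in_unit_interval)
    show "S \<subseteq> unit_interval" by (auto simp: S_def)
    have "0 \<in> S" by (simp add: S_def unit_interval_def op_le_def)
    then show "S \<noteq> {}" by auto
  next
    fix D b assume D: "D \<subseteq> S" "op_directed D" and b: "b \<in> unit_interval" "op_lub A D b"
    have DA: "a \<in> A" "positive_op a" "\<omega> a = 0" "op_le a b" if "a \<in> D" for a
      using that D b by (auto simp: S_def op_lub_def dest: unit_intervalD)
    have "D \<subseteq> A" using DA(1) by auto
    moreover have "\<forall>a\<in>D. self_adjoint a" using DA(2) positive_self_adjoint by auto
    ultimately have sup: "Re (\<phi> b) = (SUP a\<in>D. Re (\<phi> a))"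
      using \<phi> D b unfolding normal_state_def by blast
    have "(cmod (\<omega> b))\<^sup>2 \<le> 0"
    proof (rule field_le_epsilon)
      fix \<epsilon> :: real assume \<epsilon>: "\<epsilon> > 0"
      have bdd: "bdd_above ((\<lambda>a. Re (\<phi> a)) ` D)"
        using DA mono[OF _ unit_intervalD(1)[OF b(1)]] by (intro bdd_above.I2[where M = "Re (\<phi> b)"]) auto
      have "Re (\<phi> b) - \<epsilon> / (K + 1) < (SUP a\<in>D. Re (\<phi> a))" using \<epsilon> K sup by simp
      then obtain a where a: "a \<in> D" "Re (\<phi> b) - \<epsilon> / (K + 1) < Re (\<phi> a)"
        using less_cSUP_iff[OF _ bdd] D by (auto simp: op_directed_def)
      let ?c = "b - a"
      have c: "?c \<in> unit_interval" using b DA a by (intro unit_interval_diff) auto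
      note cA = unit_intervalD[OF c]
      have "(cmod (\<omega> b))\<^sup>2 = (cmod (\<omega> ?c))\<^sup>2"
        using DA a unit_intervalD[OF b(1)] by (simp add: x.diff)
      also have "\<dots> \<le> K * Re (\<phi> (?c o\<^sub>L ?c))" using cont[OF cA(1)] cA(4) by simp
      also have "\<dots> \<le> K * Re (\<phi> ?c)"
        using K cA by (intro mult_left_mono mono square_le c) auto
      also have "\<dots> \<le> K * (\<epsilon> / (K + 1))"
        using a K DA unit_intervalD[OF b(1)] by (intro mult_left_mono) (auto simp: diff)
      also have "\<dots> \<le> 0 + \<epsilon>" using \<epsilon> K by (simp add: field_simps)
      finally show "(cmod (\<omega> b))\<^sup>2 \<le> 0 + \<epsilon>" .
    qed
    then show "b \<in> S" using b by (simp add: S_def)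
  qed
  then obtain m where m: "m \<in> S" "\<And>a. a \<in> S \<Longrightarrow> op_le m a \<Longrightarrow> a = m" by blast
  note mA = unit_intervalD[of m]
  have mS: "m \<in> unit_interval" "\<omega> m = 0" using m by (auto simp: S_def)
  have e: "id_blinfun - m \<in> unit_interval"
    using mA[OF mS(1)] by (intro unit_interval_diff) (auto simp: unit_interval_def)
  have "id_blinfun - m = 0"
  proof (rule ccontr)
    assume "id_blinfun - m \<noteq> 0"
    then obtain b where b: "vector_dominated b" "b \<noteq> 0" "op_le b (id_blinfun - m)"
      using vector_dominated_exists[OF e] by blast
    have bu: "b \<in> unit_interval" using b by (simp add: vector_dominated_def)
    have "m + b \<in> unit_interval"
      using b(3) unit_intervalD[OF bu] mA[OF mS(1)] positive_add
      by (auto simp: unit_interval_def op_le_def algebra_simps)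
    then have "m + b \<in> S"
      using dom[OF b(1)] mS unit_intervalD[OF bu] mA by (simp add: S_def x.add)
    moreover have "op_le m (m + b)" using unit_intervalD[OF bu] by (simp add: op_le_def)
    ultimately show False using m(2) b(2) by fastforce
  qed
  then show ?thesis using mS by simp
qed

text \<open>A weak cluster point \<open>d\<close> of the densities \<open>x\<^sub>n\<close> has \<open>\<phi> (d a b) = \<psi> (a b)\<close> for vector dominated \<open>b\<close>, where
  \<open>\<phi> (\<cdot> b)\<close> is a matrix coefficient, and exhaustion removes \<open>b\<close>.\<close>

lemma bounded_density_limit:
  assumes vn: "von_neumann_algebra A" and \<phi>: "normal_state A \<phi>"
    and x: "\<And>n::nat. x n \<in> A" "\<And>n. norm (x n) \<le> l"
    and lim: "\<And>a. a \<in> A \<Longrightarrow> (\<lambda>n. \<phi> (x n o\<^sub>L a)) \<longlonglongrightarrow> \<psi> a"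
  shows "\<exists>d\<in>A. \<forall>a\<in>A. \<psi> a = \<phi> (d o\<^sub>L a)"
proof -
  interpret positive_functional A \<phi> using \<phi> state_iff[OF vn] by (simp add: normal_state_def)
  have one: "\<phi> id_blinfun = 1" using \<phi> by (simp add: normal_state_def state_def)
  have l: "0 \<le> l" using x(2)[of 0] norm_ge_zero order_trans by blast
  have "filtermap x sequentially \<noteq> bot" by (simp add: filtermap_bot_iff)
  moreover have "eventually (\<lambda>a. a \<in> A \<and> norm a \<le> l) (filtermap x sequentially)"
    using x by (simp add: eventually_filtermap)
  ultimately obtain d where d: "d \<in> A" and cl: "weakly_adherent (filtermap x sequentially) d"
    by (rule weak_cluster_point)
  note cl = weakly_adherentD[OF cl]
  have coeff: "inner z (blinfun_apply d v) = r"
    if "(\<lambda>n. inner z (blinfun_apply (x n) v)) \<longlonglongrightarrow> r" for z v r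
  proof -
    have "dist (inner z (blinfun_apply d v)) r \<le> 0 + \<epsilon>" if \<epsilon>: "\<epsilon> > 0" for \<epsilon>
    proof -
      have "eventually (\<lambda>n. dist (inner z (blinfun_apply (x n) v)) r < \<epsilon>) sequentially"
        using \<open>_ \<longlonglongrightarrow> r\<close> \<epsilon> by (rule tendstoD)
      then have "eventually (\<lambda>n. inner z (blinfun_apply (x n) v) \<in> cball r \<epsilon>) sequentially"
        by (rule eventually_mono) (simp add: dist_commute)
      then show ?thesis
        using cl[of "cball r \<epsilon>" z v 0 0] by (simp add: eventually_filtermap dist_commute)
    qed
    then have "dist (inner z (blinfun_apply d v)) r \<le> 0" by (rule field_le_epsilon)
    then show ?thesis by simp
  qed
  have lin\<psi>: "linear_functional A \<psi>"
  proof unfold_locales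
    fix a b assume ab: "a \<in> A" "b \<in> A"
    have "(\<lambda>n. \<phi> (x n o\<^sub>L a) + \<phi> (x n o\<^sub>L b)) \<longlonglongrightarrow> \<psi> a + \<psi> b" by (intro tendsto_intros lim ab)
    then have "(\<lambda>n. \<phi> (x n o\<^sub>L (a + b))) \<longlonglongrightarrow> \<psi> a + \<psi> b" using ab x by (simp add: compose_distribs add)
    then show "\<psi> (a + b) = \<psi> a + \<psi> b" using lim[OF add_in[OF ab]] LIMSEQ_unique by blast
  next
    fix a c assume a: "a \<in> A"
    have "(\<lambda>n. c * \<phi> (x n o\<^sub>L a)) \<longlonglongrightarrow> c * \<psi> a" by (intro tendsto_intros lim a)
    then have "(\<lambda>n. \<phi> (x n o\<^sub>L op_scale c a)) \<longlonglongrightarrow> c * \<psi> a"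
      using a x by (simp add: op_scale_comp_right scale)
    then show "\<psi> (op_scale c a) = c * \<psi> a" using lim[OF op_scale_in[OF a]] LIMSEQ_unique by blast
  qed
  interpret s: linear_functional A \<psi> by fact
  have "\<psi> a = \<phi> (d o\<^sub>L a)" if a: "a \<in> A" for a
  proof -
    define \<omega> where "\<omega> c = \<phi> (d o\<^sub>L a o\<^sub>L c) - \<psi> (a o\<^sub>L c)" for c
    define K where "K = (norm (d o\<^sub>L a))\<^sup>2"
    define L where "L = (l * norm a)\<^sup>2"
    have twist: "(cmod (\<phi> (y o\<^sub>L c)))\<^sup>2 \<le> (norm y)\<^sup>2 * Re (\<phi> (adj c o\<^sub>L c))"
      if "y \<in> A" "c \<in> A" for y c
      using Cauchy_Schwarz[OF that] square_le_norm[OF that(1)] Re_square(2)[OF that(2)] one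
      by simp (meson mult_right_mono order_trans)
    have "\<omega> id_blinfun = 0"
    proof (rule vanishing_by_exhaustion[OF vn \<phi>])
      show "linear_functional A \<omega>"
        by unfold_locales
          (use a d in \<open>simp_all add: \<omega>_def compose_distribs add s.add op_scale_comp_right scale s.scale
            algebra_simps\<close>)
    next
      fix c assume c: "c \<in> A"
      have P: "0 \<le> Re (\<phi> (adj c o\<^sub>L c))" by (rule Re_square(2)[OF c])
      have "(cmod (\<psi> (a o\<^sub>L c)))\<^sup>2 \<le> L * Re (\<phi> (adj c o\<^sub>L c))"
      proof (rule LIMSEQ_le_const2)
        show "(\<lambda>n. (cmod (\<phi> (x n o\<^sub>L (a o\<^sub>L c))))\<^sup>2) \<longlonglongrightarrow> (cmod (\<psi> (a o\<^sub>L c)))\<^sup>2"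
          by (intro tendsto_intros lim comp_in a c)
        have "(cmod (\<phi> (x n o\<^sub>L (a o\<^sub>L c))))\<^sup>2 \<le> L * Re (\<phi> (adj c o\<^sub>L c))" for n
        proof -
          have "(cmod (\<phi> (x n o\<^sub>L (a o\<^sub>L c))))\<^sup>2 \<le> (norm (x n o\<^sub>L a))\<^sup>2 * Re (\<phi> (adj c o\<^sub>L c))"
            using twist[of "x n o\<^sub>L a" c] x a c by (simp add: compose_assoc)
          also have "\<dots> \<le> L * Re (\<phi> (adj c o\<^sub>L c))"
            unfolding L_def using P x(2)[of n] 
            by (intro mult_right_mono power_mono order_trans[OF norm_compose_le]) auto
          finally show ?thesis .
        qed
        then show "\<exists>N. \<forall>n\<ge>N. (cmod (\<phi> (x n o\<^sub>L (a o\<^sub>L c))))\<^sup>2 \<le> L * Re (\<phi> (adj c o\<^sub>L c))" by blast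
      qed
      moreover have "(cmod (\<phi> (d o\<^sub>L a o\<^sub>L c)))\<^sup>2 \<le> K * Re (\<phi> (adj c o\<^sub>L c))"
        unfolding K_def using a d c by (intro twist) auto
      moreover have "(cmod (\<omega> c))\<^sup>2
          \<le> 2 * (cmod (\<phi> (d o\<^sub>L a o\<^sub>L c)))\<^sup>2 + 2 * (cmod (\<psi> (a o\<^sub>L c)))\<^sup>2"
      proof -
        have "cmod (\<omega> c) \<le> cmod (\<phi> (d o\<^sub>L a o\<^sub>L c)) + cmod (\<psi> (a o\<^sub>L c))"
          unfolding \<omega>_def by (rule norm_triangle_ineq4)
        then have "(cmod (\<omega> c))\<^sup>2 \<le> (cmod (\<phi> (d o\<^sub>L a o\<^sub>L c)) + cmod (\<psi> (a o\<^sub>L c)))\<^sup>2"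
          by (intro power_mono) auto
        also have "\<dots> \<le> 2 * (cmod (\<phi> (d o\<^sub>L a o\<^sub>L c)))\<^sup>2 + 2 * (cmod (\<psi> (a o\<^sub>L c)))\<^sup>2"
          using zero_le_power2[of "cmod (\<phi> (d o\<^sub>L a o\<^sub>L c)) - cmod (\<psi> (a o\<^sub>L c))"]
          by (simp add: power2_eq_square algebra_simps)
        finally show ?thesis .
      qed
      ultimately show "(cmod (\<omega> c))\<^sup>2 \<le> (2 * K + 2 * L) * Re (\<phi> (adj c o\<^sub>L c))"
        by (simp add: algebra_simps)
    next
      fix b assume b: "vector_dominated b"
      then have bA: "b \<in> A" by (auto simp: vector_dominated_def dest: unit_intervalD)
      obtain v z where vz: "\<And>a. a \<in> A \<Longrightarrow> Re (\<phi> (a o\<^sub>L b)) = inner z (blinfun_apply a v)"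
        using vector_dominated_coefficient[OF b] by blast
      have re: "Re (\<phi> (d o\<^sub>L a' o\<^sub>L b)) = Re (\<psi> (a' o\<^sub>L b))" if a': "a' \<in> A" for a'
      proof -
        have "(\<lambda>n. Re (\<phi> (x n o\<^sub>L (a' o\<^sub>L b)))) \<longlonglongrightarrow> Re (\<psi> (a' o\<^sub>L b))"
          by (intro tendsto_intros lim comp_in a' bA)
        moreover have "Re (\<phi> (y o\<^sub>L (a' o\<^sub>L b))) = inner z (blinfun_apply y (blinfun_apply a' v))"
          if "y \<in> A" for y
          using vz[of "y o\<^sub>L a'"] that a' by (simp add: compose_assoc)
        ultimately show ?thesis using coeff x d by (simp add: compose_assoc)
      qed
      have "Im (\<phi> (d o\<^sub>L a o\<^sub>L b)) = Im (\<psi> (a o\<^sub>L b))"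
        using re[of "op_scale \<i> a"] a d bA
        by (simp add: op_scale_comp_right op_scale_comp_left scale s.scale)
      with re[OF a] show "\<omega> b = 0" by (simp add: \<omega>_def complex_eq_iff)
    qed
    then show ?thesis by (simp add: \<omega>_def)
  qed
  with d show ?thesis by auto
qed

section \<open>Automorphisms\<close>

locale vn_automorphism = vn_algebra A for A :: "('h::chilbert_space \<Rightarrow>\<^sub>L 'h) set" +
  fixes g
  assumes aut: "normal_star_automorphism A g"
begin

lemma map_in [simp, intro]: "a \<in> A \<Longrightarrow> g a \<in> A"
  and map_add: "a \<in> A \<Longrightarrow> b \<in> A \<Longrightarrow> g (a + b) = g a + g b"
  and map_comp: "a \<in> A \<Longrightarrow> b \<in> A \<Longrightarrow> g (a o\<^sub>L b) = g a o\<^sub>L g b"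
  and map_scale: "a \<in> A \<Longrightarrow> g (op_scale c a) = op_scale c (g a)"
  and map_adj: "a \<in> A \<Longrightarrow> g (adj a) = adj (g a)"
  using aut by (auto simp: normal_star_automorphism_def bij_betw_def)

lemma map_scaleR: "a \<in> A \<Longrightarrow> g (r *\<^sub>R a) = r *\<^sub>R g a"
  by (metis map_scale op_scale_of_real)

lemma map_diff: "a \<in> A \<Longrightarrow> b \<in> A \<Longrightarrow> g (a - b) = g a - g b"
  using map_add[of a "(-1) *\<^sub>R b"] map_scaleR[of b "-1"] scaleR_in[of b "-1"] by simp

lemma map_zero [simp]: "g 0 = 0"
  using map_scaleR[of 0 0] by simp

lemma map_id [simp]: "g id_blinfun = id_blinfun"
proof -
  have "g ` A = A" using aut by (simp add: normal_star_automorphism_def bij_betw_def)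
  then have "id_blinfun \<in> g ` A" by simp
  then obtain c where c: "c \<in> A" "g c = id_blinfun" by force
  show ?thesis using map_comp[OF id_in c(1)] c by simp
qed

text \<open>Normality alone gives positivity: \<open>a \<ge> 0\<close> is the least upper bound of \<open>{0, a}\<close>.\<close>

lemma map_positive:
  assumes "a \<in> A" "positive_op a" shows "positive_op (g a)"
proof -
  have le: "op_le 0 a" using assms by (simp add: op_le_def)
  have "op_directed {0, a}" using le by (auto simp: op_directed_def)
  moreover have "op_lub A {0, a} a"
    using assms le by (auto simp: op_lub_def positive_self_adjoint)
  moreover have "{0, a} \<subseteq> A" "\<forall>c\<in>{0, a}. self_adjoint c"
    using assms by (auto simp: positive_self_adjoint)
  ultimately have "op_lub A (g ` {0, a}) (g a)"
    using aut unfolding normal_star_automorphism_def by blast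
  then have "op_le (g 0) (g a)" by (simp add: op_lub_def)
  then show ?thesis by (simp add: op_le_def)
qed

text \<open>Apply the positive unital map \<open>g\<close> to \<open>a\<^sup>* a \<le> \<parallel>a\<parallel>\<^sup>2 1\<close>.\<close>

lemma norm_map_le:
  assumes a: "a \<in> A" shows "norm (g a) \<le> norm a"
proof (rule norm_blinfun_bound)
  fix v
  have "op_le (adj (g a) o\<^sub>L g a) ((norm a)\<^sup>2 *\<^sub>R id_blinfun)"
    using map_positive[OF _ op_square_le_norm[OF a, unfolded op_le_def]] a
    by (simp add: op_le_def map_diff map_comp map_adj map_scaleR)
  from op_le_inner[OF this, of v]
  have "(norm (blinfun_apply (g a) v))\<^sup>2 \<le> (norm a * norm v)\<^sup>2"
    using a by (simp add: inner_adj_right bounded blinfun.scaleR_left power_mult_distrib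
        power2_norm_eq_inner)
  then show "norm (blinfun_apply (g a) v) \<le> norm a * norm v"
    by (simp add: power_mono_iff)
qed simp

end

lemma automorphism_group_facts:
  assumes "normal_automorphism_group A G"
  shows automorphism_group_id: "\<exists>e\<in>G. \<forall>a\<in>A. e a = a"
    and automorphism_group_comp: "g \<in> G \<Longrightarrow> h \<in> G \<Longrightarrow> \<exists>k\<in>G. \<forall>a\<in>A. k a = g (h a)"
    and automorphism_group_inv: "g \<in> G \<Longrightarrow> \<exists>k\<in>G. \<forall>a\<in>A. k (g a) = a \<and> g (k a) = a"
proof -
  have G: "subgroup G (BijGroup A)" using assms by (simp add: normal_automorphism_group_def)
  have sub: "g \<in> Bij A" if "g \<in> G" for g using subgroup.subset[OF G] that by (auto simp: BijGroup_def)
  show "\<exists>e\<in>G. \<forall>a\<in>A. e a = a"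
    using subgroup.one_closed[OF G] by (intro bexI) (auto simp: BijGroup_def)
  show "\<exists>k\<in>G. \<forall>a\<in>A. k a = g (h a)" if "g \<in> G" "h \<in> G"
    using subgroup.m_closed[OF G that] that sub
    by (intro bexI) (auto simp: BijGroup_def compose_def)
  show "\<exists>k\<in>G. \<forall>a\<in>A. k (g a) = a \<and> g (k a) = a" if g: "g \<in> G"
  proof (intro bexI ballI conjI)
    show "(\<lambda>a\<in>A. inv_into A g a) \<in> G"
      using subgroup.m_inv_closed[OF G g] by (simp add: inv_BijGroup sub[OF g])
    have bij: "bij_betw g A A" using sub[OF g] by (simp add: Bij_def)
    fix a assume a: "a \<in> A"
    have "g a \<in> A" using bij a bij_betwE by blast
    then show "restrict (inv_into A g) A (g a) = a"
      using bij a by (simp add: bij_betw_inv_into_left)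
    show "g (restrict (inv_into A g) A a) = a"
      using bij a by (simp add: bij_betw_inv_into_right)
  qed
qed

lemma positive_functional_cong:
  assumes "positive_functional A \<phi>" "\<And>a. a \<in> A \<Longrightarrow> \<psi> a = \<phi> a"
  shows "positive_functional A \<psi>"
proof -
  interpret positive_functional A \<phi> by fact
  show ?thesis by unfold_locales (use assms(2) in \<open>auto simp: add scale pos\<close>)
qed

lemma density_unique:
  assumes "von_neumann_algebra A" "state A \<phi>" "faithful A \<phi>" "p \<in> A" "q \<in> A"
    and "\<And>a. a \<in> A \<Longrightarrow> \<phi> (p o\<^sub>L a) = \<phi> (q o\<^sub>L a)"
  shows "p = q"
proof -
  let ?g = "\<lambda>a. p o\<^sub>L a"
  have "is_cocycle A {?g} \<phi> (\<lambda>_. p)" "is_cocycle A {?g} \<phi> (\<lambda>_. q)"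
    using assms(4-6) by (auto simp: is_cocycle_def)
  from cocycle_unique[OF assms(1-3) this] show ?thesis by blast
qed

section \<open>Invariant states from bounded cocycles\<close>

locale bounded_cocycle = positive_functional A \<phi>
  for A :: "('h::chilbert_space \<Rightarrow>\<^sub>L 'h) set" and \<phi> +
  fixes G x and l :: real
  assumes group: "normal_automorphism_group A G"
    and normal: "normal_state A \<phi>" and faithful: "faithful A \<phi>"
    and cocycle: "is_cocycle A G \<phi> x" and l: "l > 0" "g \<in> G \<Longrightarrow> norm (x g) \<le> l"
begin

lemma state: "state A \<phi>"
  using normal by (simp add: normal_state_def)

lemma one [simp]: "\<phi> id_blinfun = 1"
  using state by (simp add: state_def)

lemma automorphism: "g \<in> G \<Longrightarrow> vn_automorphism A g"
  by unfold_locales (use group in \<open>simp add: normal_automorphism_group_def\<close>)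

lemma group_map_in: "g \<in> G \<Longrightarrow> a \<in> A \<Longrightarrow> g a \<in> A"
  and group_map_positive: "g \<in> G \<Longrightarrow> a \<in> A \<Longrightarrow> positive_op a \<Longrightarrow> positive_op (g a)"
  and group_map_id: "g \<in> G \<Longrightarrow> g id_blinfun = id_blinfun"
  by (fact vn_automorphism.map_in[OF automorphism] vn_automorphism.map_positive[OF automorphism]
      vn_automorphism.map_id[OF automorphism])+

lemma cocycle_in: "g \<in> G \<Longrightarrow> x g \<in> A"
  and cocycle_eq: "g \<in> G \<Longrightarrow> a \<in> A \<Longrightarrow> \<phi> (x g o\<^sub>L a) = \<phi> (g a)"
  using cocycle by (auto simp: is_cocycle_def)

text \<open>The translates of \<open>\<phi>\<close> are uniformly equivalent to \<open>\<phi>\<close>: the bound on the cocycle gives one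
  inequality, and the inverse automorphism the other.\<close>

lemma translate_le:
  assumes g: "g \<in> G" and a: "a \<in> A" "positive_op a"
  shows "Re (\<phi> (g a)) \<le> l * Re (\<phi> a)"
proof -
  have "positive_functional A (\<lambda>a. \<phi> (x g o\<^sub>L a))"
  proof -
    interpret linear_functional A "\<lambda>a. \<phi> (x g o\<^sub>L a)" by (rule linear_twist[OF cocycle_in[OF g]])
    show ?thesis
      by unfold_locales
        (use pos group_map_in group_map_positive g in \<open>simp add: cocycle_eq\<close>)
  qed
  from positive_twist_le[OF cocycle_in[OF g] this a]
  have "Re (\<phi> (g a)) \<le> norm (x g) * Re (\<phi> a)" using a g by (simp add: cocycle_eq)
  also have "\<dots> \<le> l * Re (\<phi> a)" using l(2)[OF g] pos[OF a] by (intro mult_right_mono) auto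
  finally show ?thesis .
qed

lemma le_translate:
  assumes g: "g \<in> G" and a: "a \<in> A" "positive_op a"
  shows "Re (\<phi> a) \<le> l * Re (\<phi> (g a))"
proof -
  obtain k where "k \<in> G" "k (g a) = a" using automorphism_group_inv[OF group g] a by blast
  then show ?thesis
    using translate_le[of k "g a"] group_map_in[OF g a(1)] group_map_positive[OF g a] by simp
qed

text \<open>The two-sided comparison with \<open>\<phi>\<close> is carried along because it passes to averages and limits
  and makes the limit state normal and faithful.\<close>

definition admissible :: "('h \<Rightarrow>\<^sub>L 'h) \<Rightarrow> bool" where
  "admissible y \<longleftrightarrow> y \<in> A \<and> norm y \<le> l \<and> \<phi> y = 1 \<and>
     (\<forall>a\<in>A. positive_op a \<longrightarrow> Im (\<phi> (y o\<^sub>L a)) = 0 \<and> Re (\<phi> a) / l \<le> Re (\<phi> (y o\<^sub>L a)) \<and>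
        Re (\<phi> (y o\<^sub>L a)) \<le> l * Re (\<phi> a))"

text \<open>Translation of functionals, read on densities.  Admissibility of \<open>y\<close> is included so that the choice
  made in \<open>shift\<close> inherits it.\<close>

definition translate_density :: "(('h \<Rightarrow>\<^sub>L 'h) \<Rightarrow> ('h \<Rightarrow>\<^sub>L 'h)) \<Rightarrow> ('h \<Rightarrow>\<^sub>L 'h) \<Rightarrow> ('h \<Rightarrow>\<^sub>L 'h) \<Rightarrow> bool" where
  "translate_density g w y \<longleftrightarrow> admissible y \<and> (\<forall>a\<in>A. \<phi> (y o\<^sub>L a) = \<phi> (w o\<^sub>L g a))"

text \<open>Bounding all translates, and not only \<open>w\<close>, makes the set stable under \<open>G\<close> while it stays convex;
  it replaces the convex hull of the cocycle.\<close>

definition densities :: "('h \<Rightarrow>\<^sub>L 'h) set" where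
  "densities = {w \<in> A. \<forall>g\<in>G. \<exists>y. translate_density g w y}"

definition shift :: "(('h \<Rightarrow>\<^sub>L 'h) \<Rightarrow> ('h \<Rightarrow>\<^sub>L 'h)) \<Rightarrow> ('h \<Rightarrow>\<^sub>L 'h) \<Rightarrow> ('h \<Rightarrow>\<^sub>L 'h)" where
  "shift g w = (SOME y. translate_density g w y)"

definition average :: "('h \<Rightarrow>\<^sub>L 'h) \<Rightarrow> ('h \<Rightarrow>\<^sub>L 'h) \<Rightarrow> ('h \<Rightarrow>\<^sub>L 'h)" where
  "average w w' = (1/2) *\<^sub>R (w + w')"

lemma densities_in: "w \<in> densities \<Longrightarrow> w \<in> A"
  by (simp add: densities_def)

lemma shift_density: "w \<in> densities \<Longrightarrow> g \<in> G \<Longrightarrow> translate_density g w (shift g w)"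
  unfolding shift_def by (rule someI_ex) (simp add: densities_def)

lemma shift_admissible: "w \<in> densities \<Longrightarrow> g \<in> G \<Longrightarrow> admissible (shift g w)"
  and shift_in: "w \<in> densities \<Longrightarrow> g \<in> G \<Longrightarrow> shift g w \<in> A"
  and shift_eq: "w \<in> densities \<Longrightarrow> g \<in> G \<Longrightarrow> a \<in> A \<Longrightarrow> \<phi> (shift g w o\<^sub>L a) = \<phi> (w o\<^sub>L g a)"
  using shift_density[of w g] by (auto simp: translate_density_def admissible_def)

lemma shift_eqI:
  assumes "w \<in> densities" "g \<in> G" "y \<in> A" "\<And>a. a \<in> A \<Longrightarrow> \<phi> (y o\<^sub>L a) = \<phi> (w o\<^sub>L g a)"
  shows "shift g w = y"
  by (rule density_unique[OF vn state faithful]) (use assms shift_eq shift_in in auto)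

lemma id_in_densities: "id_blinfun \<in> densities"
proof -
  have "translate_density g id_blinfun (x g)" if g: "g \<in> G" for g
  proof -
    have "\<phi> (x g) = 1" using cocycle_eq[OF g id_in] group_map_id[OF g] by simp
    moreover have "Im (\<phi> (g a)) = 0 \<and> Re (\<phi> a) / l \<le> Re (\<phi> (g a)) \<and> Re (\<phi> (g a)) \<le> l * Re (\<phi> a)"
      if "a \<in> A" "positive_op a" for a
      using le_translate[OF g that] translate_le[OF g that] l(1)
        Im_pos[OF group_map_in[OF g that(1)] group_map_positive[OF g that]]
      by (simp add: field_simps)
    ultimately show ?thesis
      unfolding translate_density_def admissible_def
      using cocycle_in[OF g] l(2)[OF g] by (simp add: cocycle_eq[OF g])
  qed
  then show ?thesis by (auto simp: densities_def)
qed

lemma functional_average: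
  "y \<in> A \<Longrightarrow> z \<in> A \<Longrightarrow> a \<in> A \<Longrightarrow> \<phi> (average y z o\<^sub>L a) = (\<phi> (y o\<^sub>L a) + \<phi> (z o\<^sub>L a)) / 2"
  by (simp add: average_def compose_distribs add scaleR)

lemma average_in: "y \<in> A \<Longrightarrow> z \<in> A \<Longrightarrow> average y z \<in> A"
  by (simp add: average_def)

lemma admissible_average:
  assumes y: "admissible y" and z: "admissible z" shows "admissible (average y z)"
proof -
  have yz: "y \<in> A" "z \<in> A" using y z by (auto simp: admissible_def)
  have "norm (average y z) \<le> l"
    using y z norm_triangle_ineq[of y z] by (simp add: average_def admissible_def)
  moreover have "\<phi> (average y z) = 1"
    using functional_average[OF yz id_in] y z by (simp add: admissible_def)
  moreover have "Im (\<phi> (average y z o\<^sub>L a)) = 0 \<and> Re (\<phi> a) / l \<le> Re (\<phi> (average y z o\<^sub>L a)) \<and>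
      Re (\<phi> (average y z o\<^sub>L a)) \<le> l * Re (\<phi> a)" if a: "a \<in> A" "positive_op a" for a
  proof -
    \<comment> \<open>The abbreviation keeps arithmetic from clearing the denominator.\<close>
    define c where "c = Re (\<phi> a) / l"
    have "Im (\<phi> (y o\<^sub>L a)) = 0" "c \<le> Re (\<phi> (y o\<^sub>L a))" "Re (\<phi> (y o\<^sub>L a)) \<le> l * Re (\<phi> a)"
      "Im (\<phi> (z o\<^sub>L a)) = 0" "c \<le> Re (\<phi> (z o\<^sub>L a))" "Re (\<phi> (z o\<^sub>L a)) \<le> l * Re (\<phi> a)"
      using y z a by (auto simp: admissible_def c_def)
    then show ?thesis unfolding functional_average[OF yz a(1)] c_def[symmetric] by simp
  qed
  ultimately show ?thesis using average_in[OF yz] by (simp add: admissible_def)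
qed

lemma average_in_densities: "average w w' \<in> densities"
  and shift_average: "g \<in> G \<Longrightarrow> shift g (average w w') = average (shift g w) (shift g w')"
  if w: "w \<in> densities" "w' \<in> densities"
proof -
  have r: "translate_density g (average w w') (average (shift g w) (shift g w'))"
    if g: "g \<in> G" for g
    unfolding translate_density_def
    using w g by (simp add: admissible_average shift_admissible functional_average shift_in shift_eq
        group_map_in densities_in)
  then show m: "average w w' \<in> densities"
    unfolding densities_def using w average_in densities_in by blast
  show "shift g (average w w') = average (shift g w) (shift g w')" if "g \<in> G" for g
    using r[OF that] by (intro shift_eqI m that) (auto simp: translate_density_def admissible_def)
qed

lemma shift_shift_density:
  assumes w: "w \<in> densities" and g: "g \<in> G" and h: "h \<in> G"
  shows "\<exists>k\<in>G. translate_density g (shift h w) (shift k w)"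
proof -
  obtain k where k: "k \<in> G" "\<And>a. a \<in> A \<Longrightarrow> k a = h (g a)"
    using automorphism_group_comp[OF group h g] by blast
  then have "translate_density g (shift h w) (shift k w)"
    using w g h by (simp add: translate_density_def shift_admissible shift_eq group_map_in)
  with k show ?thesis by blast
qed

lemma shift_in_densities:
  assumes "w \<in> densities" "h \<in> G" shows "shift h w \<in> densities"
proof -
  have "\<forall>g\<in>G. \<exists>y. translate_density g (shift h w) y" using shift_shift_density assms by blast
  then show ?thesis using shift_in[OF assms] by (simp add: densities_def)
qed

lemma shift_shift:
  assumes w: "w \<in> densities" and g: "g \<in> G" and h: "h \<in> G"
  obtains k where "k \<in> G" "shift g (shift h w) = shift k w"
proof -
  obtain k where k: "k \<in> G" "translate_density g (shift h w) (shift k w)"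
    using shift_shift_density[OF assms] by blast
  then have "shift g (shift h w) = shift k w"
    using w g h shift_in_densities by (intro shift_eqI) (auto simp: translate_density_def admissible_def)
  with k show thesis using that by blast
qed

lemma densities_admissible:
  assumes w: "w \<in> densities" shows "admissible w"
proof -
  obtain e where e: "e \<in> G" "\<And>a. a \<in> A \<Longrightarrow> e a = a" using automorphism_group_id[OF group] by blast
  have "shift e w = w" by (rule shift_eqI) (use w e densities_in in auto)
  then show ?thesis using shift_admissible[OF w e(1)] by simp
qed

lemma group_nonempty: "G \<noteq> {}"
  using automorphism_group_id[OF group] by blast

text \<open>The squared Hilbert norm of the functional \<open>\<phi> (y \<cdot>)\<close> relative to \<open>\<phi>\<close>.\<close>

definition sqnorm :: "('h \<Rightarrow>\<^sub>L 'h) \<Rightarrow> real" where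
  "sqnorm y = Re (\<phi> (y o\<^sub>L adj y))"

definition sup_sqnorm :: "('h \<Rightarrow>\<^sub>L 'h) \<Rightarrow> real" where
  "sup_sqnorm w = (SUP g\<in>G. sqnorm (shift g w))"

lemma sqnorm_nonneg: "y \<in> A \<Longrightarrow> 0 \<le> sqnorm y"
  using Re_square(1) by (simp add: sqnorm_def)

lemma parallelogram:
  "y \<in> A \<Longrightarrow> z \<in> A \<Longrightarrow> sqnorm (average y z) = sqnorm y / 2 + sqnorm z / 2 - sqnorm (y - z) / 4"
  by (simp add: sqnorm_def average_def adj_add adj_diff adj_scaleR compose_distribs add diff scaleR
      algebra_simps)
    (simp add: field_simps)

lemma sqnorm_shift_le: "w \<in> densities \<Longrightarrow> g \<in> G \<Longrightarrow> sqnorm (shift g w) \<le> l\<^sup>2"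
proof -
  assume w: "w \<in> densities" "g \<in> G"
  have "sqnorm (shift g w) \<le> (norm (shift g w))\<^sup>2"
    using square_le_norm[OF shift_in[OF w]] by (simp add: sqnorm_def)
  also have "\<dots> \<le> l\<^sup>2" using shift_admissible[OF w] by (intro power_mono) (auto simp: admissible_def)
  finally show ?thesis .
qed

lemma sqnorm_shift_le_sup: "w \<in> densities \<Longrightarrow> g \<in> G \<Longrightarrow> sqnorm (shift g w) \<le> sup_sqnorm w"
  unfolding sup_sqnorm_def by (intro cSUP_upper bdd_above.I2[where M = "l\<^sup>2"] sqnorm_shift_le)

lemma sup_sqnorm_nonneg: "w \<in> densities \<Longrightarrow> 0 \<le> sup_sqnorm w"
  using group_nonempty sqnorm_shift_le_sup sqnorm_nonneg shift_in order_trans by (metis ex_in_conv)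

lemma sup_sqnorm_shift_le:
  assumes "w \<in> densities" "h \<in> G" shows "sup_sqnorm (shift h w) \<le> sup_sqnorm w"
  unfolding sup_sqnorm_def[of "shift h w"]
proof (rule cSUP_least[OF group_nonempty])
  fix g assume "g \<in> G"
  then obtain k where "k \<in> G" "shift g (shift h w) = shift k w" using shift_shift assms by blast
  then show "sqnorm (shift g (shift h w)) \<le> sup_sqnorm w" using sqnorm_shift_le_sup assms by simp
qed

text \<open>Each single \<open>sqnorm\<close> of a translate dominates the original one up to the factor \<open>l\<close>: with
  \<open>W = w - w'\<close> and \<open>Y\<close> its translate, \<open>\<phi> (W W\<^sup>*) = \<phi> (Y g\<^sup>-\<^sup>1(W\<^sup>*))\<close>, and the Cauchy--Schwarz
  inequality together with \<open>\<phi> \<circ> g\<^sup>-\<^sup>1 \<le> l \<phi>\<close> applies.\<close>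

lemma sqnorm_le_shift:
  assumes w: "w \<in> densities" "w' \<in> densities" and g: "g \<in> G"
  shows "sqnorm (w - w') \<le> l * sqnorm (shift g w - shift g w')"
proof -
  let ?W = "w - w'" let ?Y = "shift g w - shift g w'"
  have A: "w \<in> A" "w' \<in> A" "shift g w \<in> A" "shift g w' \<in> A" using w g densities_in shift_in by auto
  then have W: "?W \<in> A" and Y: "?Y \<in> A" by auto
  obtain k where k: "k \<in> G" "\<And>a. a \<in> A \<Longrightarrow> g (k a) = a"
    using automorphism_group_inv[OF group g] by blast
  interpret k: vn_automorphism A k using automorphism[OF k(1)] .
  have kW: "k (adj ?W) \<in> A" using W by auto
  have "\<phi> (?Y o\<^sub>L k (adj ?W)) = \<phi> (shift g w o\<^sub>L k (adj ?W)) - \<phi> (shift g w' o\<^sub>L k (adj ?W))"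
    using A kW by (simp add: compose_distribs(3) diff)
  also have "\<dots> = \<phi> (w o\<^sub>L adj ?W) - \<phi> (w' o\<^sub>L adj ?W)"
    using shift_eq[OF w(1) g kW] shift_eq[OF w(2) g kW] k(2)[OF adj_in[OF W]] by simp
  also have "\<dots> = \<phi> (?W o\<^sub>L adj ?W)" unfolding compose_distribs(3) using A W by (simp add: diff)
  finally have "(sqnorm ?W)\<^sup>2 \<le> (cmod (\<phi> (?Y o\<^sub>L k (adj ?W))))\<^sup>2"
    unfolding sqnorm_def by (simp add: cmod_power2)
  also have "\<dots> \<le> sqnorm ?Y * Re (\<phi> (adj (k (adj ?W)) o\<^sub>L k (adj ?W)))"
    unfolding sqnorm_def by (rule Cauchy_Schwarz[OF Y kW])
  also have "adj (k (adj ?W)) o\<^sub>L k (adj ?W) = k (?W o\<^sub>L adj ?W)"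
    using W by (simp add: k.map_comp k.map_adj)
  also have "sqnorm ?Y * Re (\<phi> (k (?W o\<^sub>L adj ?W))) \<le> sqnorm ?Y * (l * sqnorm ?W)"
    unfolding sqnorm_def[of ?W]
    by (intro mult_left_mono translate_le k(1) sqnorm_nonneg Y positive_square' comp_in adj_in W)
  finally have "sqnorm ?W * sqnorm ?W \<le> (l * sqnorm ?Y) * sqnorm ?W"
    by (simp add: power2_eq_square ac_simps)
  then show ?thesis
    using sqnorm_nonneg[OF W] sqnorm_nonneg[OF Y] l(1) by (cases "sqnorm ?W = 0") auto
qed

text \<open>The parallelogram law holds for each translate, and the defects \<open>sqnorm (Y) / 4\<close> have the common
  lower bound from \<open>sqnorm_le_shift\<close>, so they survive the supremum.\<close>

lemma sup_sqnorm_uniformly_convex: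
  assumes w: "w \<in> densities" "w' \<in> densities"
  shows "sqnorm (w - w') \<le> 2 * l * (sup_sqnorm w + sup_sqnorm w' - 2 * sup_sqnorm (average w w'))"
proof -
  have "sup_sqnorm (average w w') \<le> sup_sqnorm w / 2 + sup_sqnorm w' / 2 - sqnorm (w - w') / (4 * l)"
    unfolding sup_sqnorm_def[of "average w w'"]
  proof (rule cSUP_least[OF group_nonempty])
    fix g assume g: "g \<in> G"
    have "sqnorm (w - w') / (4 * l) \<le> sqnorm (shift g w - shift g w') / 4"
      using sqnorm_le_shift[OF w g] l(1) by (simp add: field_simps)
    then show "sqnorm (shift g (average w w'))
        \<le> sup_sqnorm w / 2 + sup_sqnorm w' / 2 - sqnorm (w - w') / (4 * l)"
      using sqnorm_shift_le_sup[OF w(1) g] sqnorm_shift_le_sup[OF w(2) g]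
        parallelogram[OF shift_in[OF w(1) g] shift_in[OF w(2) g]]
      unfolding shift_average[OF w g] by linarith
  qed
  then show ?thesis using l(1) by (simp add: field_simps)
qed

lemma functional_diff_le:
  assumes w: "w \<in> densities" "w' \<in> densities" and a: "a \<in> A"
    and m: "\<And>v. v \<in> densities \<Longrightarrow> m \<le> sup_sqnorm v"
    and \<delta>: "sup_sqnorm w \<le> m + \<delta>" "sup_sqnorm w' \<le> m + \<delta>"
  shows "(cmod (\<phi> (w o\<^sub>L a) - \<phi> (w' o\<^sub>L a)))\<^sup>2 \<le> \<delta> * (4 * l * Re (\<phi> (adj a o\<^sub>L a)))"
proof -
  have A: "w \<in> A" "w' \<in> A" using w densities_in by auto
  have "sup_sqnorm w + sup_sqnorm w' - 2 * sup_sqnorm (average w w') \<le> 2 * \<delta>"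
    using \<delta> m[OF average_in_densities[OF w]] by linarith
  then have "2 * l * (sup_sqnorm w + sup_sqnorm w' - 2 * sup_sqnorm (average w w')) \<le> 2 * l * (2 * \<delta>)"
    using l(1) by (intro mult_left_mono) auto
  from order_trans[OF sup_sqnorm_uniformly_convex[OF w] this]
  have "sqnorm (w - w') \<le> 4 * l * \<delta>" by (simp add: ac_simps)
  then have "sqnorm (w - w') * Re (\<phi> (adj a o\<^sub>L a)) \<le> 4 * l * \<delta> * Re (\<phi> (adj a o\<^sub>L a))"
    by (intro mult_right_mono Re_square a)
  moreover have "(cmod (\<phi> ((w - w') o\<^sub>L a)))\<^sup>2 \<le> sqnorm (w - w') * Re (\<phi> (adj a o\<^sub>L a))"
    unfolding sqnorm_def using A a by (intro Cauchy_Schwarz) auto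
  moreover have "\<phi> ((w - w') o\<^sub>L a) = \<phi> (w o\<^sub>L a) - \<phi> (w' o\<^sub>L a)"
    using A a by (simp add: compose_distribs diff)
  ultimately show ?thesis by (simp add: ac_simps)
qed

text \<open>A minimising sequence of \<open>sup_sqnorm\<close> defines functionals that converge pointwise; its
  translates minimise as well, so they have the same limit, which is therefore invariant.\<close>

lemma invariant_limit:
  obtains u \<psi> where "\<And>n::nat. u n \<in> densities" "\<And>a. a \<in> A \<Longrightarrow> (\<lambda>n. \<phi> (u n o\<^sub>L a)) \<longlonglongrightarrow> \<psi> a"
    "\<And>g a. g \<in> G \<Longrightarrow> a \<in> A \<Longrightarrow> \<psi> (g a) = \<psi> a"
proof -
  have "densities \<noteq> {}" using id_in_densities by auto
  moreover have "bdd_below (sup_sqnorm ` densities)"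
    using sup_sqnorm_nonneg by (intro bdd_belowI2[where m = 0])
  ultimately obtain m u where u: "\<And>n::nat. u n \<in> densities"
    and m: "\<And>w. w \<in> densities \<Longrightarrow> m \<le> sup_sqnorm w" and um: "\<And>n. sup_sqnorm (u n) < m + 1 / Suc n"
    using minimizing_sequence[of densities sup_sqnorm] by metis
  have um': "sup_sqnorm (u i) \<le> m + 1 / real (Suc n)" if "n \<le> i" for i n
  proof -
    have "1 / real (Suc i) \<le> 1 / real (Suc n)" using that by (simp add: frac_le)
    then show ?thesis using um[of i] by linarith
  qed
  have close: "\<exists>M. \<forall>w\<in>densities. \<forall>w'\<in>densities. sup_sqnorm w \<le> m + 1 / real (Suc M) \<longrightarrow>
      sup_sqnorm w' \<le> m + 1 / real (Suc M) \<longrightarrow> cmod (\<phi> (w o\<^sub>L a) - \<phi> (w' o\<^sub>L a)) < \<epsilon>"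
    if a: "a \<in> A" and \<epsilon>: "\<epsilon> > 0" for a \<epsilon>
  proof -
    define P where "P = 4 * l * Re (\<phi> (adj a o\<^sub>L a)) + 1"
    have P: "P > 0" using l(1) Re_square(2)[OF a] by (simp add: P_def add_nonneg_pos)
    obtain M where M: "1 / real (Suc M) < \<epsilon>\<^sup>2 / P"
      using small_of_inverse_Suc[of "\<epsilon>\<^sup>2 / P"] P \<epsilon> by auto
    have "cmod (\<phi> (w o\<^sub>L a) - \<phi> (w' o\<^sub>L a)) < \<epsilon>"
      if w: "w \<in> densities" "w' \<in> densities" "sup_sqnorm w \<le> m + 1 / real (Suc M)"
        "sup_sqnorm w' \<le> m + 1 / real (Suc M)" for w w'
    proof -
      have "(cmod (\<phi> (w o\<^sub>L a) - \<phi> (w' o\<^sub>L a)))\<^sup>2 \<le> 1 / real (Suc M) * (4 * l * Re (\<phi> (adj a o\<^sub>L a)))"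
        by (rule functional_diff_le[OF w(1,2) a m w(3,4)])
      also have "\<dots> \<le> 1 / real (Suc M) * P" by (intro mult_left_mono) (auto simp: P_def)
      also have "\<dots> < \<epsilon>\<^sup>2" using M P by (simp only: pos_less_divide_eq)
      finally show ?thesis using \<epsilon> by (intro power2_less_imp_less[of _ \<epsilon>]) auto
    qed
    then show ?thesis by blast
  qed
  have "convergent (\<lambda>n. \<phi> (u n o\<^sub>L a))" if a: "a \<in> A" for a
  proof -
    have "Cauchy (\<lambda>n. \<phi> (u n o\<^sub>L a))"
    proof (rule CauchyI)
      fix \<epsilon> :: real assume "\<epsilon> > 0"
      from close[OF a this] show "\<exists>M. \<forall>i\<ge>M. \<forall>j\<ge>M. norm (\<phi> (u i o\<^sub>L a) - \<phi> (u j o\<^sub>L a)) < \<epsilon>"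
        using u um' by blast
    qed
    then show ?thesis by (rule Cauchy_convergent)
  qed
  then have lim: "(\<lambda>n. \<phi> (u n o\<^sub>L a)) \<longlonglongrightarrow> lim (\<lambda>n. \<phi> (u n o\<^sub>L a))" if "a \<in> A" for a
    using that by (simp add: convergent_LIMSEQ_iff)
  define \<psi> where "\<psi> a = lim (\<lambda>n. \<phi> (u n o\<^sub>L a))" for a
  have "\<psi> (g a) = \<psi> a" if g: "g \<in> G" and a: "a \<in> A" for g a
  proof -
    have "(\<lambda>n. \<phi> (u n o\<^sub>L a) - \<phi> (shift g (u n) o\<^sub>L a)) \<longlonglongrightarrow> 0"
    proof (rule LIMSEQ_I)
      fix \<epsilon> :: real assume "\<epsilon> > 0"
      from close[OF a this] obtain M where
        M: "\<And>w w'. w \<in> densities \<Longrightarrow> w' \<in> densities \<Longrightarrow> sup_sqnorm w \<le> m + 1 / real (Suc M) \<Longrightarrow>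
          sup_sqnorm w' \<le> m + 1 / real (Suc M) \<Longrightarrow> cmod (\<phi> (w o\<^sub>L a) - \<phi> (w' o\<^sub>L a)) < \<epsilon>"
        by blast
      have "norm (\<phi> (u n o\<^sub>L a) - \<phi> (shift g (u n) o\<^sub>L a) - 0) < \<epsilon>" if "n \<ge> M" for n
        using M[OF u shift_in_densities[OF u g] um'[OF that]
            order_trans[OF sup_sqnorm_shift_le[OF u g] um'[OF that]]] by simp
      then show "\<exists>M. \<forall>n\<ge>M. norm (\<phi> (u n o\<^sub>L a) - \<phi> (shift g (u n) o\<^sub>L a) - 0) < \<epsilon>" by blast
    qed
    moreover have "(\<lambda>n. \<phi> (u n o\<^sub>L a) - \<phi> (shift g (u n) o\<^sub>L a)) \<longlonglongrightarrow> \<psi> a - \<psi> (g a)"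
      unfolding \<psi>_def shift_eq[OF u g a] by (intro tendsto_diff lim a group_map_in[OF g])
    ultimately have "\<psi> a - \<psi> (g a) = 0" using LIMSEQ_unique by blast
    then show ?thesis by simp
  qed
  with u lim show thesis by (intro that[of u \<psi>]) (auto simp: \<psi>_def)
qed

lemma invariant_state_exists:
  "\<exists>\<psi>. normal_state A \<psi> \<and> faithful A \<psi> \<and> invariant A G \<psi> \<and> (\<exists>d\<in>A. \<forall>a\<in>A. \<psi> a = \<phi> (d o\<^sub>L a))"
proof -
  obtain u \<psi>' where u: "\<And>n::nat. u n \<in> densities"
    and lim': "\<And>a. a \<in> A \<Longrightarrow> (\<lambda>n. \<phi> (u n o\<^sub>L a)) \<longlonglongrightarrow> \<psi>' a"
    and inv': "\<And>g a. g \<in> G \<Longrightarrow> a \<in> A \<Longrightarrow> \<psi>' (g a) = \<psi>' a"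
    using invariant_limit by blast
  have adm: "admissible (u n)" for n using densities_admissible u by blast
  have "\<exists>d\<in>A. \<forall>a\<in>A. \<psi>' a = \<phi> (d o\<^sub>L a)"
    using adm by (intro bounded_density_limit[OF vn normal, of u l] lim') (auto simp: admissible_def)
  then obtain d where d: "d \<in> A" "\<And>a. a \<in> A \<Longrightarrow> \<psi>' a = \<phi> (d o\<^sub>L a)" by blast
  define \<psi> where "\<psi> a = \<phi> (d o\<^sub>L a)" for a
  have lim: "(\<lambda>n. \<phi> (u n o\<^sub>L a)) \<longlonglongrightarrow> \<psi> a" if "a \<in> A" for a
    using lim'[OF that] d(2)[OF that] by (simp add: \<psi>_def)
  have between: "Im (\<psi> a) = 0" "Re (\<phi> a) / l \<le> Re (\<psi> a)" "Re (\<psi> a) \<le> l * Re (\<phi> a)"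
    if a: "a \<in> A" "positive_op a" for a
  proof -
    have u: "Im (\<phi> (u n o\<^sub>L a)) = 0" "Re (\<phi> a) / l \<le> Re (\<phi> (u n o\<^sub>L a))"
      "Re (\<phi> (u n o\<^sub>L a)) \<le> l * Re (\<phi> a)" for n
      using adm[of n] a by (auto simp: admissible_def)
    have "(\<lambda>n. Im (\<phi> (u n o\<^sub>L a))) \<longlonglongrightarrow> Im (\<psi> a)" by (intro tendsto_Im lim a)
    then show "Im (\<psi> a) = 0" unfolding u by (simp add: LIMSEQ_const_iff)
    have re: "(\<lambda>n. Re (\<phi> (u n o\<^sub>L a))) \<longlonglongrightarrow> Re (\<psi> a)" by (intro tendsto_Re lim a)
    show "Re (\<phi> a) / l \<le> Re (\<psi> a)" by (rule LIMSEQ_le_const[OF re]) (use u in blast)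
    show "Re (\<psi> a) \<le> l * Re (\<phi> a)" by (rule LIMSEQ_le_const2[OF re]) (use u in blast)
  qed
  have "\<psi> id_blinfun = 1"
    using lim[OF id_in] adm by (simp add: admissible_def LIMSEQ_const_iff)
  moreover have "positive_functional A \<psi>"
  proof -
    interpret s: linear_functional A \<psi> unfolding \<psi>_def[abs_def] by (rule linear_twist[OF d(1)])
    show ?thesis
    proof
      fix a assume a: "a \<in> A" "positive_op a"
      have "0 \<le> Re (\<phi> a) / l" using pos[OF a] l(1) by simp
      then show "\<psi> a \<in> \<real> \<and> 0 \<le> Re (\<psi> a)"
        using between[OF a] by (auto simp: complex_is_Real_iff)
    qed
  qed
  ultimately have st: "state A \<psi>" by (simp add: state_iff[OF vn])
  have "normal_state A \<psi>"
    using l(1) between(3) by (intro normal_state_dominated[OF vn normal st, of l]) auto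
  moreover have "faithful A \<psi>"
    unfolding faithful_def
  proof (intro ballI impI)
    fix a assume a: "a \<in> A" "positive_op a" "\<psi> a = 0"
    have "Re (\<phi> a) \<le> 0" using between(2)[OF a(1,2)] a(3) l(1) by (simp add: field_simps)
    then have "\<phi> a = 0" using pos[OF a(1,2)] Im_pos[OF a(1,2)] by (simp add: complex_eq_iff)
    then show "a = 0" using faithful a by (auto simp: faithful_def)
  qed
  moreover have "invariant A G \<psi>"
    using inv' d(2) group_map_in by (simp add: invariant_def \<psi>_def)
  ultimately show ?thesis using d(1) by (intro exI[of _ \<psi>]) (auto simp: \<psi>_def)
qed

end

section \<open>Quasi-invariance from an invertible density\<close>

lemma (in vn_algebra) inverse_in:
  assumes "d \<in> A" "e \<in> bounded_ops" "d o\<^sub>L e = id_blinfun" "e o\<^sub>L d = id_blinfun"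
  shows "e \<in> A"
proof -
  have "t o\<^sub>L e = e o\<^sub>L t" if "t \<in> commutant A" for t
  proof -
    have "d o\<^sub>L t = t o\<^sub>L d" using that assms(1) by (simp add: commutant_def)
    then have "e o\<^sub>L (d o\<^sub>L t) o\<^sub>L e = e o\<^sub>L (t o\<^sub>L d) o\<^sub>L e" by simp
    then have "(e o\<^sub>L d) o\<^sub>L t o\<^sub>L e = e o\<^sub>L t o\<^sub>L (d o\<^sub>L e)" by (simp only: compose_assoc)
    then show ?thesis using assms by simp
  qed
  then have "e \<in> commutant (commutant A)" using assms by (auto simp: commutant_def[of "commutant A"])
  then show ?thesis by (simp add: bicommutant)
qed

lemma quasi_invariant_of_invertible_density:
  assumes vn: "von_neumann_algebra A" and G: "normal_automorphism_group A G"
    and st: "state A \<phi>" and \<psi>: "normal_state A \<psi>" "faithful A \<psi>" "invariant A G \<psi>"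
    and d: "d \<in> A" "op_invertible d" "\<And>a. a \<in> A \<Longrightarrow> \<psi> a = \<phi> (d o\<^sub>L a)"
  shows "quasi_invariant A G \<phi> \<and> (\<exists>x. is_cocycle A G \<phi> x \<and> uniformly_bounded G x)"
proof -
  interpret p: positive_functional A \<phi> using st state_iff[OF vn] by simp
  have \<psi>st: "state A \<psi>" using \<psi> by (simp add: normal_state_def)
  interpret q: positive_functional A \<psi> using \<psi>st state_iff[OF vn] by simp
  obtain e where e: "e \<in> bounded_ops" "d o\<^sub>L e = id_blinfun" "e o\<^sub>L d = id_blinfun"
    using d by (auto simp: op_invertible_def)
  have eA: "e \<in> A" by (rule p.inverse_in[OF d(1) e])
  have \<phi>e: "\<phi> a = \<psi> (e o\<^sub>L a)" if "a \<in> A" for a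
    using d(3)[of "e o\<^sub>L a"] eA that e(2) by (simp flip: compose_assoc)
  have twd: "positive_functional A (\<lambda>a. \<phi> (d o\<^sub>L a))"
    by (rule positive_functional_cong[OF q.positive_functional_axioms]) (simp add: d)
  have twe: "positive_functional A (\<lambda>a. \<psi> (e o\<^sub>L a))"
    by (rule positive_functional_cong[OF p.positive_functional_axioms]) (simp add: \<phi>e)
  have "normal_state A \<phi>"
  proof (rule normal_state_dominated[OF vn \<psi>(1) st norm_ge_zero])
    show "Re (\<phi> a) \<le> norm e * Re (\<psi> a)" if "a \<in> A" "positive_op a" for a
      using q.positive_twist_le[OF eA twe that] \<phi>e[OF that(1)] by simp
  qed
  moreover have "faithful A \<phi>"
    unfolding faithful_def
  proof (intro ballI impI)
    fix a assume a: "a \<in> A" "positive_op a" "\<phi> a = 0"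
    have "Re (\<psi> a) \<le> 0" using p.positive_twist_le[OF d(1) twd a(1,2)] a d(3)[OF a(1)] by simp
    then have "\<psi> a = 0" using q.pos[OF a(1,2)] q.Im_pos[OF a(1,2)] by (simp add: complex_eq_iff)
    then show "a = 0" using \<psi> a by (auto simp: faithful_def)
  qed
  moreover have "\<exists>y\<in>A. norm y \<le> norm d * norm e \<and> (\<forall>a\<in>A. \<phi> (g a) = \<phi> (y o\<^sub>L a))" if g: "g \<in> G" for g
  proof -
    obtain k where k: "k \<in> G" "\<And>a. a \<in> A \<Longrightarrow> g (k a) = a" using automorphism_group_inv[OF G g] by blast
    interpret g: vn_automorphism A g
      using G g by unfold_locales (simp add: normal_automorphism_group_def)
    interpret k: vn_automorphism A k
      using G k by unfold_locales (simp add: normal_automorphism_group_def)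
    have "norm (d o\<^sub>L k e) \<le> norm d * norm e"
      by (intro order_trans[OF norm_compose_le] mult_left_mono k.norm_map_le eA) simp
    moreover have "\<phi> (g a) = \<phi> (d o\<^sub>L k e o\<^sub>L a)" if a: "a \<in> A" for a
    proof -
      have "\<phi> (g a) = \<psi> (g (k e o\<^sub>L a))" using \<phi>e a eA k(2) by (simp add: g.map_comp)
      also have "\<dots> = \<psi> (k e o\<^sub>L a)" using \<psi>(3) g a eA by (simp add: invariant_def)
      finally show ?thesis using d(3)[of "k e o\<^sub>L a"] a eA by (simp add: compose_assoc)
    qed
    ultimately show ?thesis using d(1) eA by (intro bexI[of _ "d o\<^sub>L k e"]) auto
  qed
  then obtain x where x: "\<And>g. g \<in> G \<Longrightarrow> x g \<in> A \<and> norm (x g) \<le> norm d * norm e \<and>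
      (\<forall>a\<in>A. \<phi> (g a) = \<phi> (x g o\<^sub>L a))" by metis
  have "is_cocycle A G \<phi> x" using x by (simp add: is_cocycle_def)
  moreover have "uniformly_bounded G x"
    unfolding uniformly_bounded_def using x
    by (intro exI[of _ "norm d * norm e + 1"]) (auto intro: add_nonneg_pos add_increasing2)
  ultimately show ?thesis unfolding quasi_invariant_def is_cocycle_def by blast
qed

theorem theorem3p2:
  fixes A :: "('h::chilbert_space \<Rightarrow>\<^sub>L 'h) set"
    and G :: "(('h \<Rightarrow>\<^sub>L 'h) \<Rightarrow> ('h \<Rightarrow>\<^sub>L 'h)) set"
  assumes "von_neumann_algebra A" and "normal_automorphism_group A G"
  shows
    "(\<forall>\<phi> x. quasi_invariant A G \<phi> \<and> is_cocycle A G \<phi> x \<and> uniformly_bounded G x \<longrightarrow>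
        (\<exists>\<psi>. normal_state A \<psi> \<and> faithful A \<psi> \<and> invariant A G \<psi> \<and>
          (\<exists>d\<in>A. \<forall>a\<in>A. \<psi> a = \<phi> (d o\<^sub>L a)))) \<and>
     (\<forall>\<phi>. state A \<phi> \<and>
        (\<exists>\<psi>. normal_state A \<psi> \<and> faithful A \<psi> \<and> invariant A G \<psi> \<and>
          (\<exists>d\<in>A. op_invertible d \<and> (\<forall>a\<in>A. \<psi> a = \<phi> (d o\<^sub>L a)))) \<longrightarrow>
        quasi_invariant A G \<phi> \<and> (\<exists>x. is_cocycle A G \<phi> x \<and> uniformly_bounded G x))"
proof (intro conjI allI impI)
  fix \<phi> x assume *: "quasi_invariant A G \<phi> \<and> is_cocycle A G \<phi> x \<and> uniformly_bounded G x"
  then obtain l where l: "l > 0" "\<And>g. g \<in> G \<Longrightarrow> norm (x g) \<le> l" by (auto simp: uniformly_bounded_def)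
  then show "\<exists>\<psi>. normal_state A \<psi> \<and> faithful A \<psi> \<and> invariant A G \<psi> \<and>
      (\<exists>d\<in>A. \<forall>a\<in>A. \<psi> a = \<phi> (d o\<^sub>L a))"
  proof -
    have "positive_functional A \<phi>"
      using * state_iff[OF assms(1)] by (simp add: quasi_invariant_def normal_state_def)
    then have "bounded_cocycle A \<phi> G x l"
      using * l assms(2)
      by (auto simp: bounded_cocycle_def bounded_cocycle_axioms_def quasi_invariant_def)
    then show ?thesis by (rule bounded_cocycle.invariant_state_exists)
  qed
qed (use quasi_invariant_of_invertible_density[OF assms] in blast)+

end
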